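(* Let $G$ be a finitely generated, free-by-finite group. Then the outer automorphism group $\mathrm{Out}(G)$ of $G$ is residually finite.
   Context: A group is free-by-finite if it has a normal free subgroup of finite index. $\mathrm{Out}(G)=\mathrm{Aut}(G)/\mathrm{Inn}(G)$, where $\mathrm{Inn}(G)$ is the group of inner automorphisms. A group is residually finite if the intersection of its finite-index subgroups is trivial. *)

theory Defs
  imports "HOL-Algebra.Bij" "HOL-Algebra.Generated_Groups"
begin

definition finitely_generated_group :: "('a, 'b) monoid_scheme \<Rightarrow> bool" where
  "finitely_generated_group G \<longleftrightarrow>
     group G \<and> (\<exists>S. finite S \<and> S \<subseteq> carrier G \<and> generate G S = carrier G)"

definition finite_index :: "'a set \<Rightarrow> ('a, 'b) monoid_scheme \<Rightarrow> bool" where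
  "finite_index H G \<longleftrightarrow> subgroup H G \<and> finite (rcosets\<^bsub>G\<^esub> H)"

text \<open>A word over a set \<open>B\<close> is a list of letters \<open>(x, b)\<close> with \<open>x \<in> B\<close>; the letter
  \<open>(x, True)\<close> stands for \<open>x\<close> and \<open>(x, False)\<close> for its inverse.\<close>

definition reduced_word :: "('a \<times> bool) list \<Rightarrow> bool" where
  "reduced_word w \<longleftrightarrow> successively (\<lambda>(x, b) (y, c). \<not> (x = y \<and> b \<noteq> c)) w"

definition word_value :: "('a, 'b) monoid_scheme \<Rightarrow> ('a \<times> bool) list \<Rightarrow> 'a" where
  "word_value G w =
     foldr (\<lambda>(x, b) g. (if b then x else inv\<^bsub>G\<^esub> x) \<otimes>\<^bsub>G\<^esub> g) w \<one>\<^bsub>G\<^esub>"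

definition free_basis :: "('a, 'b) monoid_scheme \<Rightarrow> 'a set \<Rightarrow> bool" where
  "free_basis G B \<longleftrightarrow> B \<subseteq> carrier G \<and>
     (\<forall>g \<in> carrier G. \<exists>!w. w \<in> lists (B \<times> UNIV) \<and> reduced_word w \<and> word_value G w = g)"

text \<open>The basis may be empty or infinite, so the trivial group is free.\<close>

definition free_group :: "('a, 'b) monoid_scheme \<Rightarrow> bool" where
  "free_group G \<longleftrightarrow> group G \<and> (\<exists>B. free_basis G B)"

definition free_by_finite :: "('a, 'b) monoid_scheme \<Rightarrow> bool" where
  "free_by_finite G \<longleftrightarrow>
     (\<exists>N. N \<lhd> G \<and> free_group (G\<lparr>carrier := N\<rparr>) \<and> finite_index N G)"

text \<open>Automorphisms in \<^const>\<open>AutoGroup\<close> are extensional functions, hence the restriction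
  of conjugation to the carrier.\<close>

definition inner_aut :: "('a, 'b) monoid_scheme \<Rightarrow> 'a \<Rightarrow> 'a \<Rightarrow> 'a" where
  "inner_aut G g = (\<lambda>x \<in> carrier G. g \<otimes>\<^bsub>G\<^esub> x \<otimes>\<^bsub>G\<^esub> inv\<^bsub>G\<^esub> g)"

definition Inn :: "('a, 'b) monoid_scheme \<Rightarrow> ('a \<Rightarrow> 'a) set" where
  "Inn G = inner_aut G ` carrier G"

definition Out :: "('a, 'b) monoid_scheme \<Rightarrow> ('a \<Rightarrow> 'a) set monoid" where
  "Out G = AutoGroup G Mod Inn G"

definition residually_finite :: "('a, 'b) monoid_scheme \<Rightarrow> bool" where
  "residually_finite G \<longleftrightarrow> group G \<and> \<Inter> {H. finite_index H G} = {\<one>\<^bsub>G\<^esub>}"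

context group
begin

lemma inner_aut_bij: "g \<in> carrier G \<Longrightarrow> inner_aut G g \<in> Bij (carrier G)"
  unfolding Bij_def inner_aut_def
  by (auto intro!: bij_betw_byWitness[where f' = "\<lambda>x. inv g \<otimes> x \<otimes> g"]
      simp: m_assoc inv_solve_left inv_solve_left')
     (simp_all flip: m_assoc)

lemma inner_aut_auto: "g \<in> carrier G \<Longrightarrow> inner_aut G g \<in> auto G"
proof -
  assume g: "g \<in> carrier G"
  have "g \<otimes> (x \<otimes> y) \<otimes> inv g = (g \<otimes> x \<otimes> inv g) \<otimes> (g \<otimes> y \<otimes> inv g)"
    if "x \<in> carrier G" "y \<in> carrier G" for x y
    using that g by (simp add: m_assoc inv_solve_left)
  then show ?thesis
    using inner_aut_bij[OF g] g by (auto simp: auto_def hom_def inner_aut_def)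
qed

lemma carrier_AutoGroup: "carrier (AutoGroup G) = auto G"
  by (simp add: AutoGroup_def)

lemma mult_AutoGroup:
  "f \<in> auto G \<Longrightarrow> h \<in> auto G \<Longrightarrow> f \<otimes>\<^bsub>AutoGroup G\<^esub> h = compose (carrier G) f h"
  by (simp add: AutoGroup_def BijGroup_def auto_def)

lemma one_AutoGroup: "\<one>\<^bsub>AutoGroup G\<^esub> = (\<lambda>x \<in> carrier G. x)"
  by (simp add: AutoGroup_def BijGroup_def)

lemma inner_aut_mult:
  assumes "g \<in> carrier G" "h \<in> carrier G"
  shows "inner_aut G g \<otimes>\<^bsub>AutoGroup G\<^esub> inner_aut G h = inner_aut G (g \<otimes> h)"
proof -
  have "compose (carrier G) (inner_aut G g) (inner_aut G h) = inner_aut G (g \<otimes> h)"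
    using assms by (auto simp: compose_def inner_aut_def inv_mult_group m_assoc)
  then show ?thesis
    using assms by (simp add: mult_AutoGroup inner_aut_auto)
qed

lemma inner_aut_conj:
  assumes "f \<in> auto G" "g \<in> carrier G"
  shows "f \<otimes>\<^bsub>AutoGroup G\<^esub> inner_aut G g = inner_aut G (f g) \<otimes>\<^bsub>AutoGroup G\<^esub> f"
proof -
  interpret f: group_hom G G f
    using assms(1) by unfold_locales (auto simp: auto_def)
  have "compose (carrier G) f (inner_aut G g) = compose (carrier G) (inner_aut G (f g)) f"
    using assms(2) by (auto simp: compose_def inner_aut_def)
  then show ?thesis
    using assms by (simp add: mult_AutoGroup inner_aut_auto)
qed

lemma inner_aut_hom: "inner_aut G \<in> hom G (AutoGroup G)"
  by (auto simp: hom_def carrier_AutoGroup inner_aut_auto inner_aut_mult)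

lemma Inn_normal: "Inn G \<lhd> AutoGroup G"
proof -
  interpret A: group "AutoGroup G" by (rule AutoGroup)
  interpret c: group_hom G "AutoGroup G" "inner_aut G"
    by unfold_locales (rule inner_aut_hom)
  have "f \<otimes>\<^bsub>AutoGroup G\<^esub> h \<otimes>\<^bsub>AutoGroup G\<^esub> inv\<^bsub>AutoGroup G\<^esub> f \<in> Inn G"
    if f: "f \<in> carrier (AutoGroup G)" and h: "h \<in> Inn G" for f h
  proof -
    obtain g where g: "g \<in> carrier G" "h = inner_aut G g"
      using h by (auto simp: Inn_def)
    have "f g \<in> carrier G"
      using f g(1) by (auto simp: carrier_AutoGroup auto_def hom_def)
    moreover have "f \<otimes>\<^bsub>AutoGroup G\<^esub> h \<otimes>\<^bsub>AutoGroup G\<^esub> inv\<^bsub>AutoGroup G\<^esub> f = inner_aut G (f g)"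
      using f g calculation
      by (simp add: inner_aut_conj flip: carrier_AutoGroup)
         (simp add: A.m_assoc inner_aut_auto carrier_AutoGroup[symmetric])
    ultimately show ?thesis
      by (simp add: Inn_def)
  qed
  then show ?thesis
    using c.img_is_subgroup by (simp add: A.normal_inv_iff Inn_def)
qed

lemma group_Out: "group (Out G)"
  unfolding Out_def by (rule normal.factorgroup_is_group[OF Inn_normal])

end

end

theory Submission
  imports Defs "HOL-Algebra.Elementary_Groups" "HOL-Combinatorics.Permutations"
begin

text \<open>Let \<open>N\<close> be the free normal subgroup. An automorphism \<open>\<phi>\<close> whose class lies in every finite-index
  subgroup of \<open>Out G\<close> agrees modulo every finite-index normal subgroup with some conjugation, and after
  composing it with an inner automorphism the conjugating elements lie in \<open>N\<close>.

  Suppose that \<open>\<phi> z\<close>, for \<open>z \<in> N\<close>, is conjugate to a cyclically reduced word \<open>w\<close>. The cycle labelled by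
  \<open>w\<close> completes to a finite permutation action of \<open>N\<close> in which \<open>w\<close> has a fixed point, hence \<open>z\<close>
  has one too. But the action can be chosen so that basis elements, and also a given product of two
  of them if \<open>w\<close> is long enough, have no fixed point. Hence \<open>\<phi>\<close> sends each basis element \<open>a\<close> to a conjugate
  of itself, and the words for \<open>\<phi> (a \<otimes> c)\<close> force the conjugating elements to be the same for all basis
  elements. So \<open>\<phi>\<close> is inner on \<open>N\<close>; if it is the identity on \<open>N\<close>, then \<open>\<phi> x \<otimes> inv x\<close> is central in \<open>N\<close>,
  and the only case with a nontrivial centre, \<open>N\<close> infinite cyclic, is settled by arithmetic.\<close>

section \<open>Words and free groups\<close>

definition cancels :: "'a \<times> bool \<Rightarrow> 'a \<times> bool \<Rightarrow> bool" where
  "cancels k l \<longleftrightarrow> fst k = fst l \<and> snd k \<noteq> snd l"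

lemma reduced_word_iff: "reduced_word w \<longleftrightarrow> successively (\<lambda>k l. \<not> cancels k l) w"
  unfolding reduced_word_def cancels_def
  by (intro iffI; erule successively_mono) auto

lemma cancels_commute: "cancels k l \<longleftrightarrow> cancels l k"
  by (auto simp: cancels_def)

lemma reduced_word_Nil [simp]: "reduced_word []"
  and reduced_word_single [simp]: "reduced_word [l]"
  by (simp_all add: reduced_word_iff)

lemma reduced_word_Cons:
  "reduced_word (l # w) \<longleftrightarrow> reduced_word w \<and> (w \<noteq> [] \<longrightarrow> \<not> cancels l (hd w))"
  by (cases w) (auto simp: reduced_word_iff)

lemma reduced_word_append:
  "reduced_word (u @ v) \<longleftrightarrow> reduced_word u \<and> reduced_word v \<and>
     (u \<noteq> [] \<longrightarrow> v \<noteq> [] \<longrightarrow> \<not> cancels (last u) (hd v))"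
  by (auto simp: reduced_word_iff successively_append_iff)

section \<open>Inverse words\<close>

definition inverse_word :: "('a \<times> bool) list \<Rightarrow> ('a \<times> bool) list" where
  "inverse_word w = rev (map (apsnd Not) w)"

lemma inverse_word_Nil [simp]: "inverse_word [] = []"
  and inverse_word_Cons: "inverse_word (l # w) = inverse_word w @ [apsnd Not l]"
  and inverse_word_eq_Nil [simp]: "inverse_word w = [] \<longleftrightarrow> w = []"
  by (simp_all add: inverse_word_def)

lemma cancels_Not [simp]: "cancels (apsnd Not k) (apsnd Not l) \<longleftrightarrow> cancels k l"
  by (auto simp: cancels_def)

lemma hd_inverse_word: "w \<noteq> [] \<Longrightarrow> hd (inverse_word w) = apsnd Not (last w)"
  and last_inverse_word: "w \<noteq> [] \<Longrightarrow> last (inverse_word w) = apsnd Not (hd w)"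
  by (simp_all add: inverse_word_def hd_rev last_rev last_map hd_map)

lemma reduced_inverse_word: "reduced_word w \<Longrightarrow> reduced_word (inverse_word w)"
proof (induction w)
  case (Cons l w)
  then show ?case
    by (auto simp: reduced_word_Cons reduced_word_append inverse_word_Cons last_inverse_word
        cancels_commute)
qed simp

lemma set_inverse_word: "set w \<subseteq> B \<times> UNIV \<Longrightarrow> set (inverse_word w) \<subseteq> B \<times> UNIV"
  by (auto simp: inverse_word_def)

text \<open>Left multiplication of a reduced word by one letter, so that
  \<open>foldr push w []\<close> is the free reduction of \<open>w\<close>.\<close>

fun push :: "'a \<times> bool \<Rightarrow> ('a \<times> bool) list \<Rightarrow> ('a \<times> bool) list" where
  "push l [] = [l]"
| "push l (k # w) = (if cancels l k then w else l # k # w)"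

lemma reduced_push: "reduced_word w \<Longrightarrow> reduced_word (push l w)"
  by (cases w) (auto simp: reduced_word_Cons)

lemma set_push: "l \<in> S \<Longrightarrow> set w \<subseteq> S \<Longrightarrow> set (push l w) \<subseteq> S"
  by (cases w) auto

lemma reduced_foldr_push: "reduced_word (foldr push w [])"
  by (induction w) (auto intro: reduced_push)

lemma set_foldr_push: "set w \<subseteq> S \<Longrightarrow> set (foldr push w []) \<subseteq> S"
proof (induction w)
  case (Cons l w)
  then show ?case
    using set_push[of l S "foldr push w []"] by simp
qed simp

section \<open>Values of words and the universal property of free groups\<close>

lemma word_value_Nil [simp]: "word_value G [] = \<one>\<^bsub>G\<^esub>"
  by (simp add: word_value_def)

lemma word_value_Cons [simp]:
  "word_value G (l # w) = (if snd l then fst l else inv\<^bsub>G\<^esub> (fst l)) \<otimes>\<^bsub>G\<^esub> word_value G w"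
  by (simp add: word_value_def case_prod_unfold)

context group
begin

lemma word_value_closed [simp]:
  "set w \<subseteq> carrier G \<times> UNIV \<Longrightarrow> word_value G w \<in> carrier G"
  by (induction w) auto

lemma word_value_append:
  "set u \<subseteq> carrier G \<times> UNIV \<Longrightarrow> set v \<subseteq> carrier G \<times> UNIV \<Longrightarrow>
    word_value G (u @ v) = word_value G u \<otimes> word_value G v"
  by (induction u) (auto simp: m_assoc)

lemma word_value_inverse_word:
  "set w \<subseteq> carrier G \<times> UNIV \<Longrightarrow> word_value G (inverse_word w) = inv (word_value G w)"
proof (induction w)
  case (Cons l w)
  then show ?case
    using set_inverse_word[of w "carrier G"]
    by (auto simp: inverse_word_Cons word_value_append inv_mult_group)
qed simp

text \<open>Cancelling letters have mutually inverse images. The map \<open>f\<close> on letters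
  lets one statement serve both for words over a basis and for their images in another
  group.\<close>

lemma word_value_push:
  assumes "l \<in> A \<times> UNIV" "set w \<subseteq> A \<times> UNIV" "f \<in> A \<rightarrow> carrier G"
  shows "word_value G (map (apfst f) (push l w)) = word_value G (map (apfst f) (l # w))"
proof (cases w)
  case (Cons k v)
  have "word_value G (map (apfst f) v) \<in> carrier G"
    using assms Cons by (intro word_value_closed) auto
  then show ?thesis
    using assms Cons by (auto simp: cancels_def Pi_iff simp flip: m_assoc)
qed simp

lemma word_value_foldr_push:
  assumes "set w \<subseteq> A \<times> UNIV" "f \<in> A \<rightarrow> carrier G"
  shows "word_value G (map (apfst f) (foldr push w [])) = word_value G (map (apfst f) w)"
  using assms(1)
proof (induction w)
  case (Cons l w)
  then show ?case
    using word_value_push[OF _ set_foldr_push assms(2), of l w] by simp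
qed simp

lemma hom_word_value:
  assumes "group H" "h \<in> hom G H" "set w \<subseteq> carrier G \<times> UNIV"
  shows "h (word_value G w) = word_value H (map (apfst h) w)"
proof -
  interpret h: group_hom G H h
    using assms by (simp add: group_hom_def group_hom_axioms_def)
  show ?thesis
    using assms(3) by (induction w) auto
qed

lemma free_basis_subset: "free_basis G B \<Longrightarrow> B \<subseteq> carrier G"
  by (simp add: free_basis_def)

lemma free_basis_words: "free_basis G B \<Longrightarrow> set w \<subseteq> B \<times> UNIV \<Longrightarrow> set w \<subseteq> carrier G \<times> UNIV"
  by (auto simp: free_basis_def)

lemma free_basis_reduced_unique:
  assumes "free_basis G B" "set u \<subseteq> B \<times> UNIV" "set v \<subseteq> B \<times> UNIV"
    "reduced_word u" "reduced_word v" "word_value G u = word_value G v"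
  shows "u = v"
  using assms free_basis_words[OF assms(1,2)] unfolding free_basis_def lists_eq_set
  by (metis (no_types, lifting) mem_Collect_eq word_value_closed)

lemma free_basis_obtain_word:
  assumes "free_basis G B" "g \<in> carrier G"
  obtains w where "set w \<subseteq> B \<times> UNIV" "reduced_word w" "word_value G w = g"
  using assms unfolding free_basis_def lists_eq_set by (metis (no_types, lifting) mem_Collect_eq)

text \<open>An element is sent to the value of \<open>f\<close> along its reduced word. Free
  reduction preserves values in \<open>H\<close>, so every word for the element gives the same
  result, and concatenating words yields multiplicativity.\<close>

theorem free_basis_universal:
  assumes B: "free_basis G B" and H: "group H" and f: "f \<in> B \<rightarrow> carrier H"
  obtains h where "h \<in> hom G H" "\<And>x. x \<in> B \<Longrightarrow> h x = f x"
proof -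
  interpret H: group H by fact
  note words = free_basis_words[OF B]
  have "\<exists>w. set w \<subseteq> B \<times> UNIV \<and> reduced_word w \<and> word_value G w = g" if "g \<in> carrier G" for g
    using free_basis_obtain_word[OF B that] by blast
  then obtain rw where rw: "\<And>g. g \<in> carrier G \<Longrightarrow>
      set (rw g) \<subseteq> B \<times> UNIV \<and> reduced_word (rw g) \<and> word_value G (rw g) = g"
    by metis
  define h where "h g = word_value H (map (apfst f) (rw g))" for g
  have h: "h (word_value G w) = word_value H (map (apfst f) w)" if w: "set w \<subseteq> B \<times> UNIV" for w
  proof -
    have "word_value G (foldr push w []) = word_value G w"
      using word_value_foldr_push[OF w, of "\<lambda>x. x"] free_basis_subset[OF B]
      by (simp add: apfst_def subset_iff Pi_iff map_prod_def)
    moreover have "word_value G w \<in> carrier G"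
      using words[OF w] by simp
    ultimately have "rw (word_value G w) = foldr push w []"
      using rw set_foldr_push[OF w] reduced_foldr_push free_basis_reduced_unique[OF B] by metis
    then show ?thesis
      using H.word_value_foldr_push[OF w f] by (simp add: h_def)
  qed
  have fw: "set (map (apfst f) w) \<subseteq> carrier H \<times> UNIV" if "set w \<subseteq> B \<times> UNIV" for w
    using that f by auto
  have "h \<in> hom G H"
  proof (rule homI)
    fix x assume "x \<in> carrier G"
    then show "h x \<in> carrier H"
      unfolding h_def using rw by (intro H.word_value_closed fw) simp
  next
    fix x y assume xy: "x \<in> carrier G" "y \<in> carrier G"
    have "h (x \<otimes> y) = h (word_value G (rw x @ rw y))"
      using rw xy by (subst word_value_append) (simp_all add: words)
    also have "\<dots> = word_value H (map (apfst f) (rw x @ rw y))"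
      using rw xy by (intro h) auto
    also have "\<dots> = h x \<otimes>\<^bsub>H\<^esub> h y"
      unfolding map_append h_def using rw xy by (intro H.word_value_append fw) simp_all
    finally show "h (x \<otimes> y) = h x \<otimes>\<^bsub>H\<^esub> h y" .
  qed
  moreover have "h x = f x" if "x \<in> B" for x
    using h[of "[(x, True)]"] that free_basis_subset[OF B] f by (auto simp: Pi_iff subset_iff)
  ultimately show ?thesis
    using that by blast
qed

end

section \<open>Cycle actions\<close>

text \<open>Products compose from right to left, so the last letter of a word acts first; the
  orientation in \<open>cycle_edge\<close> depends on this.\<close>

definition perm_group :: "'a set \<Rightarrow> ('a \<Rightarrow> 'a) monoid" where
  "perm_group X = \<lparr>carrier = {p. p permutes X}, monoid.mult = (\<circ>), one = id\<rparr>"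

lemma perm_group_simps [simp]:
  "carrier (perm_group X) = {p. p permutes X}"
  "p \<otimes>\<^bsub>perm_group X\<^esub> q = p \<circ> q"
  "\<one>\<^bsub>perm_group X\<^esub> = id"
  by (simp_all add: perm_group_def)

lemma group_perm_group: "group (perm_group X)"
proof (rule groupI)
  fix p assume "p \<in> carrier (perm_group X)"
  then show "\<exists>q\<in>carrier (perm_group X). q \<otimes>\<^bsub>perm_group X\<^esub> p = \<one>\<^bsub>perm_group X\<^esub>"
    by (intro bexI[of _ "Hilbert_Choice.inv p"]) (auto simp: permutes_inv permutes_inv_o)
qed (auto simp: permutes_id permutes_compose)

lemma inv_perm_group [simp]:
  assumes "p permutes X"
  shows "inv\<^bsub>perm_group X\<^esub> p = Hilbert_Choice.inv p"
proof -
  interpret group "perm_group X" by (rule group_perm_group)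
  show ?thesis
    using assms by (intro inv_equality) (auto simp: permutes_inv permutes_inv_o)
qed

text \<open>The doubling \<open>X \<times> bool\<close> of \<open>X\<close> on which a partial injection extends to a permutation without
  new fixed points: forwards on the sheet \<open>False\<close>, backwards on the sheet \<open>True\<close>, and switching the
  sheet wherever the partial injection or its inverse is undefined.\<close>

fun double :: "('a \<Rightarrow> 'a \<Rightarrow> bool) \<Rightarrow> 'a \<times> bool \<Rightarrow> 'a \<times> bool" where
  "double R (u, False) = (if \<exists>v. R u v then (THE v. R u v, False) else (u, True))"
| "double R (u, True) = (if \<exists>v. R v u then (THE v. R v u, True) else (u, False))"

definition partial_injection :: "('a \<Rightarrow> 'a \<Rightarrow> bool) \<Rightarrow> 'a set \<Rightarrow> bool" where
  "partial_injection R X \<longleftrightarrow> (\<forall>u v. R u v \<longrightarrow> u \<in> X \<and> v \<in> X) \<and>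
     (\<forall>u v v'. R u v \<longrightarrow> R u v' \<longrightarrow> v = v') \<and> (\<forall>u u' v. R u v \<longrightarrow> R u' v \<longrightarrow> u = u')"

lemma double_False:
  assumes "partial_injection R X" "R u v"
  shows "double R (u, False) = (v, False)"
  using assms by (auto simp: partial_injection_def)

lemma double_True:
  assumes "partial_injection R X" "R u v"
  shows "double R (v, True) = (u, True)"
  using assms by (auto simp: partial_injection_def)

lemma double_undefined:
  "\<nexists>v. R u v \<Longrightarrow> double R (u, False) = (u, True)"
  "\<nexists>v. R v u \<Longrightarrow> double R (u, True) = (u, False)"
  by simp_all

declare double.simps [simp del]

lemma double_cases:
  assumes "partial_injection R X"
  obtains v where "R u v" "\<not> s" "double R (u, s) = (v, s)"
    | v where "R v u" "s" "double R (u, s) = (v, s)"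
    | "double R (u, s) = (u, \<not> s)"
proof (cases s)
  case True
  then show ?thesis
    using double_True[OF assms, of _ u] double_undefined(2)[of R u] that(2,3) by (cases "\<exists>v. R v u") auto
next
  case False
  then show ?thesis
    using double_False[OF assms, of u] double_undefined(1)[of R u] that(1,3) by (cases "\<exists>v. R u v") auto
qed

text \<open>One sheet runs the partial injection forwards and the other backwards, so conjugating by
  the change of sheet inverts \<open>double R\<close>.\<close>

lemma double_flip_double:
  assumes "partial_injection R X"
  shows "double R (apsnd Not (double R (apsnd Not p))) = p"
proof (cases p)
  case (Pair u s)
  show ?thesis
  proof (cases s)
    case True
    then show ?thesis
      using Pair assms by (cases "\<exists>v. R u v") (auto simp: double_False double_True double_undefined)
  next
    case False
    then show ?thesis
      using Pair assms by (cases "\<exists>v. R v u") (auto simp: double_False double_True double_undefined)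
  qed
qed

lemma fst_double_in:
  assumes "partial_injection R X"
  shows "fst (double R p) \<in> X \<longleftrightarrow> fst p \<in> X"
proof (cases p)
  case (Pair u s)
  show ?thesis
    by (rule double_cases[OF assms, of u s])
       (use Pair assms in \<open>auto simp: partial_injection_def\<close>)
qed

lemma bij_double:
  assumes "partial_injection R X"
  shows "bij_betw (double R) (X \<times> UNIV) (X \<times> UNIV)"
proof -
  have flip: "apsnd Not (apsnd Not q) = q" for q :: "'a \<times> bool"
    by (cases q) simp
  have "apsnd Not (double R (apsnd Not (double R p))) = p" for p
    using double_flip_double[OF assms, of "apsnd Not p"] by (simp add: flip)
  moreover have "double R p \<in> X \<times> UNIV \<longleftrightarrow> p \<in> X \<times> UNIV"
    "apsnd Not p \<in> X \<times> UNIV \<longleftrightarrow> p \<in> X \<times> UNIV" for p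
    by (simp_all add: mem_Times_iff fst_double_in[OF assms])
  ultimately show ?thesis
    by (intro bij_betw_byWitness[where f' = "\<lambda>p. apsnd Not (double R (apsnd Not p))"] ballI)
       (auto simp: double_flip_double[OF assms] image_subset_iff simp del: mem_Times_iff mem_Sigma_iff)
qed

text \<open>The vertices are the positions of \<open>w\<close> modulo its length. Positive letters
  point from \<open>Suc i\<close> back to \<open>i\<close> because the last letter acts first:
  reading all of \<open>w\<close> from vertex 0 then goes once round the cycle and returns to
  0.\<close>

definition cycle_edge :: "('a \<times> bool) list \<Rightarrow> 'a \<Rightarrow> nat \<Rightarrow> nat \<Rightarrow> bool" where
  "cycle_edge w x u v \<longleftrightarrow> (\<exists>i s. i < length w \<and> w ! i = (x, s) \<and>
     u = (if s then Suc i mod length w else i) \<and> v = (if s then i else Suc i mod length w))"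

lemma successively_nth: "successively P w \<Longrightarrow> Suc i < length w \<Longrightarrow> P (w ! i) (w ! Suc i)"
proof (induction w arbitrary: i)
  case (Cons l w)
  then show ?case
    by (cases i; cases w) auto
qed simp

lemma cyclically_reduced_nth:
  assumes "reduced_word (w @ w)" "i < length w"
  shows "\<not> cancels (w ! i) (w ! (Suc i mod length w))"
proof -
  have "\<not> cancels ((w @ w) ! i) ((w @ w) ! Suc i)"
    using assms by (intro successively_nth[of "\<lambda>k l. \<not> cancels k l"]) (auto simp: reduced_word_iff)
  then show ?thesis
    using assms(2) by (cases "Suc i = length w") (auto simp: nth_append)
qed

lemma Suc_mod_inj: "i < m \<Longrightarrow> j < m \<Longrightarrow> Suc i mod m = Suc j mod m \<Longrightarrow> i = j"
  by (auto simp: mod_Suc split: if_splits)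

text \<open>Two edges with the same label and a common source or target come from one position, or
  from neighbouring positions carrying inverse letters, which cyclic reducedness excludes.\<close>

lemma partial_injection_cycle_edge:
  assumes "reduced_word (w @ w)"
  shows "partial_injection (cycle_edge w x) {..<length w}"
proof -
  have opp: False if "i < length w" "w ! i = (x, s)" "w ! (Suc i mod length w) = (x, \<not> s)" for i s
    using cyclically_reduced_nth[OF assms that(1)] that by (simp add: cancels_def)
  \<comment> \<open>The flag \<open>r\<close> handles common sources (\<open>r = True\<close>) and
    common targets (\<open>r = False\<close>) at once.\<close>
  have inj: "p = q" if "i < length w" "w ! i = (x, s)" "j < length w" "w ! j = (x, t)"
    "(if s = r then Suc i mod length w else i) = (if t = r then Suc j mod length w else j)"
    "p = (if s = r then i else Suc i mod length w)" "q = (if t = r then j else Suc j mod length w)"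
    for i s j t r p q
  proof (cases "s = t")
    case True
    then show ?thesis
      using that Suc_mod_inj[of i "length w" j] by (simp split: if_splits)
  next
    case False
    then have "\<not> s = t" "t = (\<not> s)"
      by auto
    then show ?thesis
      using that opp[of i s] opp[of j t] by (cases "s = r") auto
  qed
  have "v = v'" if E: "cycle_edge w x u v" and E': "cycle_edge w x u v'" for u v v'
  proof -
    obtain i s where i: "i < length w" "w ! i = (x, s)"
      "u = (if s then Suc i mod length w else i)" "v = (if s then i else Suc i mod length w)"
      using E unfolding cycle_edge_def by blast
    obtain j t where j: "j < length w" "w ! j = (x, t)"
      "u = (if t then Suc j mod length w else j)" "v' = (if t then j else Suc j mod length w)"
      using E' unfolding cycle_edge_def by blast
    show ?thesis
      by (rule inj[OF i(1,2) j(1,2), of True]) (use i j in simp_all)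
  qed
  moreover have "u = u'" if E: "cycle_edge w x u v" and E': "cycle_edge w x u' v" for u u' v
  proof -
    obtain i s where i: "i < length w" "w ! i = (x, s)"
      "u = (if s then Suc i mod length w else i)" "v = (if s then i else Suc i mod length w)"
      using E unfolding cycle_edge_def by blast
    obtain j t where j: "j < length w" "w ! j = (x, t)"
      "u' = (if t then Suc j mod length w else j)" "v = (if t then j else Suc j mod length w)"
      using E' unfolding cycle_edge_def by blast
    show ?thesis
      by (rule inj[OF i(1,2) j(1,2), of False]) (use i j in auto)
  qed
  moreover have "u < length w \<and> v < length w" if "cycle_edge w x u v" for u v
    using that unfolding cycle_edge_def by (elim exE conjE) (auto intro: mod_less_divisor)
  ultimately show ?thesis
    unfolding partial_injection_def lessThan_iff by blast
qed

lemma cycle_edgeE: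
  assumes "cycle_edge w x u v \<or> cycle_edge w x v u"
  obtains i s where "i < length w" "w ! i = (x, s)" "{u, v} = {i, Suc i mod length w}"
proof -
  have "\<exists>i s. i < length w \<and> w ! i = (x, s) \<and> {u', v'} = {i, Suc i mod length w}"
    if "cycle_edge w x u' v'" for u' v'
  proof -
    obtain i s where "i < length w" "w ! i = (x, s)"
        "u' = (if s then Suc i mod length w else i)" "v' = (if s then i else Suc i mod length w)"
      using \<open>cycle_edge w x u' v'\<close> unfolding cycle_edge_def by blast
    then show ?thesis
      by (intro exI[of _ i] exI[of _ s]) auto
  qed
  from assms this[of u v] this[of v u] show ?thesis
    using that by (auto simp: insert_commute)
qed

text \<open>Only a cycle with a single vertex has a loop.\<close>

lemma cycle_edge_irrefl:
  assumes "2 \<le> length w" "cycle_edge w x u v"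
  shows "u \<noteq> v"
proof -
  obtain i s where "i < length w" "w ! i = (x, s)" "{u, v} = {i, Suc i mod length w}"
    by (rule cycle_edgeE[OF disjI1[OF assms(2)]])
  then show ?thesis
    using assms(1) by (auto simp: doubleton_eq_iff mod_Suc split: if_splits)
qed

text \<open>From three vertices on, two neighbouring vertices determine the position of the edge
  between them; on a cycle of length two both edges join the same pair.\<close>

lemma cycle_edge_label_unique:
  assumes "3 \<le> length w" "cycle_edge w x u v \<or> cycle_edge w x v u"
    "cycle_edge w y u v \<or> cycle_edge w y v u"
  shows "x = y"
proof -
  obtain i s where i: "i < length w" "w ! i = (x, s)" "{u, v} = {i, Suc i mod length w}"
    by (rule cycle_edgeE[OF assms(2)])
  obtain j t where j: "j < length w" "w ! j = (y, t)" "{u, v} = {j, Suc j mod length w}"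
    by (rule cycle_edgeE[OF assms(3)])
  have "{i, Suc i mod length w} = {j, Suc j mod length w}"
    using i(3) j(3) by simp
  then have "i = j"
    using i(1) j(1) assms(1) by (auto simp: doubleton_eq_iff mod_Suc split: if_splits)
  then show ?thesis
    using i(2) j(2) by simp
qed

text \<open>The generator \<open>a\<close> switches the first sheet coordinate and all other generators the second one, so
  that a fixed point of a product of \<open>a\<close> with another generator would come from a closed path of
  length two in the cycle itself.\<close>

definition cycle_perm :: "'a \<Rightarrow> ('a \<times> bool) list \<Rightarrow> 'a \<Rightarrow> nat \<times> bool \<times> bool \<Rightarrow> nat \<times> bool \<times> bool" where
  "cycle_perm a w x = (\<lambda>(u, s, t).
     if u \<ge> length w then (u, s, t)
     else if x = a then (fst (double (cycle_edge w x) (u, s)), snd (double (cycle_edge w x) (u, s)), t)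
     else (fst (double (cycle_edge w x) (u, t)), s, snd (double (cycle_edge w x) (u, t))))"

lemma cycle_perm_permutes:
  assumes "reduced_word (w @ w)"
  shows "cycle_perm a w x permutes {..<length w} \<times> UNIV"
proof (rule bij_imp_permutes)
  let ?X = "{..<length w} \<times> (UNIV :: (bool \<times> bool) set)"
  note pi = partial_injection_cycle_edge[OF assms, of x]
  have inj: "p = q" if "double (cycle_edge w x) p = double (cycle_edge w x) q"
    "fst p < length w" "fst q < length w" for p q
    using inj_onD[OF bij_betw_imp_inj_on[OF bij_double[OF pi]] that(1)] that(2,3)
    by (simp add: mem_Times_iff)
  have "cycle_perm a w x ` ?X \<subseteq> ?X"
    using fst_double_in[OF pi] by (auto simp: cycle_perm_def split: if_splits)
  moreover have "inj_on (cycle_perm a w x) ?X"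
  proof (rule inj_onI)
    fix p q assume "p \<in> ?X" "q \<in> ?X" and eq: "cycle_perm a w x p = cycle_perm a w x q"
    then obtain u s t u' s' t' where pq: "p = (u, s, t)" "q = (u', s', t')" "u < length w" "u' < length w"
      by auto
    show "p = q"
    proof (cases "x = a")
      case True
      then have "double (cycle_edge w x) (u, s) = double (cycle_edge w x) (u', s')" "t = t'"
        using eq pq by (auto simp: cycle_perm_def prod_eq_iff)
      then show ?thesis
        using inj[of "(u, s)" "(u', s')"] pq by simp
    next
      case False
      then have "double (cycle_edge w x) (u, t) = double (cycle_edge w x) (u', t')" "s = s'"
        using eq pq by (auto simp: cycle_perm_def prod_eq_iff)
      then show ?thesis
        using inj[of "(u, t)" "(u', t')"] pq by simp
    qed
  qed
  ultimately show "bij_betw (cycle_perm a w x) ?X ?X"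
    by (simp add: bij_betw_def endo_inj_surj)
qed (auto simp: cycle_perm_def split: if_splits)

lemma cycle_perm_edge:
  assumes "reduced_word (w @ w)" "cycle_edge w x u v"
  shows "cycle_perm a w x (u, False, False) = (v, False, False)"
proof -
  note pi = partial_injection_cycle_edge[OF assms(1), of x]
  then have "u < length w"
    using assms(2) by (simp add: partial_injection_def)
  then show ?thesis
    using double_False[OF pi assms(2)] by (auto simp: cycle_perm_def)
qed

lemma cycle_perm_cases:
  assumes "reduced_word (w @ w)" "u < length w"
  obtains v where "cycle_edge w x u v \<or> cycle_edge w x v u" "cycle_perm a w x (u, s, t) = (v, s, t)"
  | "x = a" "cycle_perm a w x (u, s, t) = (u, \<not> s, t)"
  | "x \<noteq> a" "cycle_perm a w x (u, s, t) = (u, s, \<not> t)"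
proof (cases "x = a")
  case True
  show ?thesis
    by (rule double_cases[OF partial_injection_cycle_edge[OF assms(1), of x], of u s])
       (use True that(1,2) assms(2) in \<open>auto simp: cycle_perm_def\<close>)
next
  case False
  show ?thesis
    by (rule double_cases[OF partial_injection_cycle_edge[OF assms(1), of x], of u t])
       (use False that(1,3) assms(2) in \<open>auto simp: cycle_perm_def\<close>)
qed

lemma cycle_perm_no_fixpoint:
  assumes "reduced_word (w @ w)" "2 \<le> length w" "fst p < length w"
  shows "cycle_perm a w x p \<noteq> p"
proof (cases p)
  case (fields u s t)
  show ?thesis
    by (rule cycle_perm_cases[OF assms(1), of u x a s t])
       (use assms fields cycle_edge_irrefl[OF assms(2)] in auto)
qed

lemma cycle_perm_product_no_fixpoint:
  assumes "reduced_word (w @ w)" "3 \<le> length w" "fst p < length w" "x \<noteq> a"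
  shows "cycle_perm a w a (cycle_perm a w x p) \<noteq> p"
proof
  assume fixed: "cycle_perm a w a (cycle_perm a w x p) = p"
  obtain u s t where p: "p = (u, s, t)"
    by (cases p)
  have u: "u < length w"
    using assms(3) p by simp
  show False
  proof (rule cycle_perm_cases[OF assms(1) u, of x a s t])
    \<comment> \<open>\<open>x\<close> moves along an edge. To bring the point back,
      \<open>a\<close> would have to use an edge between the same two vertices, which would then
      carry two labels.\<close>
    fix v assume v: "cycle_edge w x u v \<or> cycle_edge w x v u" "cycle_perm a w x (u, s, t) = (v, s, t)"
    have fixed': "cycle_perm a w a (v, s, t) = (u, s, t)"
      using fixed v(2) p by simp
    have "v < length w"
      using v(1) partial_injection_cycle_edge[OF assms(1)] by (auto simp: partial_injection_def)
    then show False
    proof (rule cycle_perm_cases[OF assms(1), of v a a s t])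
      fix v' assume v': "cycle_edge w a v v' \<or> cycle_edge w a v' v" "cycle_perm a w a (v, s, t) = (v', s, t)"
      have "v' = u"
        using fixed' v'(2) by simp
      then show False
        using cycle_edge_label_unique[OF assms(2) v(1), of a] v'(1) assms(4) by blast
    qed (use fixed' in simp_all)
  next
    \<comment> \<open>\<open>x\<close> switches the second sheet coordinate, which \<open>a\<close>
      never changes.\<close>
    assume "cycle_perm a w x (u, s, t) = (u, s, \<not> t)"
    then have fixed': "cycle_perm a w a (u, s, \<not> t) = (u, s, t)"
      using fixed p by simp
    show False
      by (rule cycle_perm_cases[OF assms(1) u, of a a s "\<not> t"]) (use fixed' in simp_all)
  qed (use assms(4) in simp)
qed

lemma (in group) cycle_action:
  assumes B: "free_basis G B" and w: "reduced_word (w @ w)" "set w \<subseteq> B \<times> UNIV" "2 \<le> length w"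
  obtains X :: "(nat \<times> bool \<times> bool) set" and h where "finite X" "h \<in> hom G (perm_group X)"
    "\<exists>p\<in>X. h (word_value G w) p = p"
    "\<And>x p. x \<in> B \<Longrightarrow> p \<in> X \<Longrightarrow> h x p \<noteq> p"
    "\<And>x p. 3 \<le> length w \<Longrightarrow> a \<in> B \<Longrightarrow> x \<in> B \<Longrightarrow> x \<noteq> a \<Longrightarrow> p \<in> X \<Longrightarrow> h (a \<otimes> x) p \<noteq> p"
proof -
  define m where "m = length w"
  define X where "X = {..<m} \<times> (UNIV :: (bool \<times> bool) set)"
  have perm: "cycle_perm a w x permutes X" for x
    unfolding X_def m_def by (rule cycle_perm_permutes[OF w(1)])
  then have "cycle_perm a w \<in> B \<rightarrow> carrier (perm_group X)"
    by simp
  then obtain h where h: "h \<in> hom G (perm_group X)" "\<And>x. x \<in> B \<Longrightarrow> h x = cycle_perm a w x"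
    using free_basis_universal[OF B group_perm_group] by metis
  interpret h: group_hom G "perm_group X" h
    using h(1) by (simp add: group_hom_def group_hom_axioms_def group_perm_group is_group)
  \<comment> \<open>Downward induction on \<open>k\<close>: the suffix from position
    \<open>k\<close> takes the base vertex to \<open>k mod m\<close>. The empty suffix gives
    \<open>m mod m = 0\<close>, and \<open>k = 0\<close> shows that the whole word fixes the base
    vertex.\<close>
  have "h (word_value G (drop k w)) (0, False, False) = (k mod m, False, False)" if "k \<le> m" for k
    using that
  proof (induction rule: inc_induct)
    case base
    then show ?case
      by (simp add: m_def)
  next
    case (step k)
    obtain x s where l: "w ! k = (x, s)"
      by fastforce
    have k: "k < length w" "drop k w = (x, s) # drop (Suc k) w"
      using step l by (auto simp: m_def Cons_nth_drop_Suc[symmetric])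
    have x: "x \<in> B" "x \<in> carrier G"
      using w(2) k l nth_mem[OF k(1)] free_basis_subset[OF B] by auto
    have "set (drop (Suc k) w) \<subseteq> carrier G \<times> UNIV"
      using free_basis_words[OF B w(2)] set_drop_subset by fastforce
    then have "h (word_value G (drop k w)) =
        (if s then cycle_perm a w x else Hilbert_Choice.inv (cycle_perm a w x)) \<circ> h (word_value G (drop (Suc k) w))"
      using x perm by (simp add: k(2) h(2))
    moreover have "(if s then cycle_perm a w x else Hilbert_Choice.inv (cycle_perm a w x))
        (Suc k mod m, False, False) = (k, False, False)"
    proof (cases s)
      case True
      then have "cycle_edge w x (Suc k mod m) k"
        using k l by (auto simp: cycle_edge_def m_def)
      then show ?thesis
        using cycle_perm_edge[OF w(1)] True by simp
    next
      case False
      then have "cycle_edge w x k (Suc k mod m)"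
        using k l by (auto simp: cycle_edge_def m_def)
      then show ?thesis
        using cycle_perm_edge[OF w(1)] False by (simp add: permutes_inv_eq[OF perm])
    qed
    ultimately show ?case
      using step k(1) by (simp add: m_def)
  qed
  from this[of 0] have fixed: "h (word_value G w) (0, False, False) = (0, False, False)"
    by simp
  show ?thesis
  proof (rule that)
    show "finite X"
      by (simp add: X_def)
    show "h \<in> hom G (perm_group X)"
      by (rule h)
    show "\<exists>p\<in>X. h (word_value G w) p = p"
      using fixed w(3) by (intro bexI[of _ "(0, False, False)"]) (auto simp: X_def m_def)
    show "h x p \<noteq> p" if "x \<in> B" "p \<in> X" for x p
      using that cycle_perm_no_fixpoint[OF w(1,3)] by (auto simp: h(2) X_def m_def)
    show "h (a \<otimes> x) p \<noteq> p" if "3 \<le> length w" "a \<in> B" "x \<in> B" "x \<noteq> a" "p \<in> X" for x p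
    proof -
      have "h (a \<otimes> x) = cycle_perm a w a \<circ> cycle_perm a w x"
        using that free_basis_subset[OF B] by (auto simp: h(2) subset_iff)
      then show ?thesis
        using that cycle_perm_product_no_fixpoint[OF w(1)] by (auto simp: X_def m_def)
    qed
  qed
qed

section \<open>Approximately inner endomorphisms of free groups\<close>

context group
begin

lemma inv_mult_cancel [simp]:
  "x \<in> carrier G \<Longrightarrow> y \<in> carrier G \<Longrightarrow> inv x \<otimes> (x \<otimes> y) = y"
  "x \<in> carrier G \<Longrightarrow> y \<in> carrier G \<Longrightarrow> x \<otimes> (inv x \<otimes> y) = y"
  by (simp_all flip: m_assoc)

lemma hom_eq_on_basis:
  assumes B: "free_basis G B" and H: "group H" and hk: "h \<in> hom G H" "k \<in> hom G H"
    and eq: "\<And>x. x \<in> B \<Longrightarrow> h x = k x" and g: "g \<in> carrier G"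
  shows "h g = k g"
proof -
  obtain w where w: "set w \<subseteq> B \<times> UNIV" "word_value G w = g"
    using free_basis_obtain_word[OF B g] .
  have "map (apfst h) w = map (apfst k) w"
    using w(1) eq by (auto simp: apfst_def)
  then show ?thesis
    using hom_word_value[OF H hk(1) free_basis_words[OF B w(1)]]
      hom_word_value[OF H hk(2) free_basis_words[OF B w(1)]] w(2) by metis
qed

text \<open>As long as the last letter cancels the first, both are stripped and the first one moves
  into the conjugator.\<close>

lemma free_basis_conj_cyclically_reduced:
  assumes B: "free_basis G B" and y: "y \<in> carrier G"
  obtains u w where "u \<in> carrier G" "set w \<subseteq> B \<times> UNIV" "reduced_word (w @ w)"
    "y = u \<otimes> word_value G w \<otimes> inv u"
proof -
  have "\<exists>u w. u \<in> carrier G \<and> set w \<subseteq> B \<times> UNIV \<and> reduced_word (w @ w) \<and>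
      word_value G v = u \<otimes> word_value G w \<otimes> inv u" if "set v \<subseteq> B \<times> UNIV" "reduced_word v" for v
    using that
  proof (induction v rule: length_induct)
    case (1 v)
    note vG = free_basis_words[OF B 1(2)]
    show ?case
    proof (cases "reduced_word (v @ v)")
      case True
      then show ?thesis
        using 1(2) vG by (intro exI[of _ \<one>] exI[of _ v]) auto
    next
      case False
      then have v: "v \<noteq> []" "cancels (last v) (hd v)"
        using 1(3) by (auto simp: reduced_word_append)
      then obtain l v' where lv: "v = l # v'"
        by (cases v) auto
      \<comment> \<open>A letter does not cancel itself, so the first and last letters are different
        occurrences.\<close>
      have "v' \<noteq> []"
        using v lv by (auto simp: cancels_def)
      then obtain v'' k where v': "v' = v'' @ [k]"
        by (cases v' rule: rev_cases) auto
      define L where "L = word_value G [l]"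
      have L: "L \<in> carrier G"
        using vG lv unfolding L_def by (intro word_value_closed) auto
      have "word_value G [k] = inv L"
        using v vG lv v' by (auto simp: L_def cancels_def)
      moreover have "word_value G v = L \<otimes> (word_value G v'' \<otimes> word_value G [k])"
        using vG lv v' word_value_append[of "[l]" "v'' @ [k]"] word_value_append[of v'' "[k]"]
        by (simp add: L_def)
      ultimately have val: "word_value G v = L \<otimes> (word_value G v'' \<otimes> inv L)"
        by simp
      have "length v'' < length v" "set v'' \<subseteq> B \<times> UNIV" "reduced_word v''"
        using 1(2,3) lv v' by (auto simp: reduced_word_Cons reduced_word_append)
      then obtain u w where uw: "u \<in> carrier G" "set w \<subseteq> B \<times> UNIV" "reduced_word (w @ w)"
          "word_value G v'' = u \<otimes> word_value G w \<otimes> inv u"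
        using 1(1) by blast
      have "word_value G w \<in> carrier G"
        using free_basis_words[OF B uw(2)] by simp
      then have "word_value G v = (L \<otimes> u) \<otimes> word_value G w \<otimes> inv (L \<otimes> u)"
        using val uw(1,4) L by (simp add: m_assoc inv_mult_group)
      then show ?thesis
        using uw L by blast
    qed
  qed
  then show ?thesis
    using free_basis_obtain_word[OF B y] that by metis
qed

text \<open>Each fibre of \<open>f\<close> lies in one right coset of \<open>H\<close>, so there are
  at most as many cosets as values of \<open>f\<close>.\<close>

lemma finite_indexI:
  assumes H: "subgroup H G" and fin: "finite (f ` carrier G)"
    and eq: "\<And>x y. x \<in> carrier G \<Longrightarrow> y \<in> carrier G \<Longrightarrow> f x = f y \<Longrightarrow> x \<otimes> inv y \<in> H"
  shows "finite_index H G"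
proof -
  have coset: "H #> x = H #> y" if "x \<in> carrier G" "y \<in> carrier G" "f x = f y" for x y
  proof (rule repr_independence[OF _ _ H, symmetric])
    have "(x \<otimes> inv y) \<otimes> y \<in> H #> y"
      using eq[OF that] by (auto simp: r_coset_def)
    then show "x \<in> H #> y"
      using that by (simp add: m_assoc)
  qed (use that in auto)
  have "rcosets H \<subseteq> (\<lambda>s. H #> (SOME x. x \<in> carrier G \<and> f x = s)) ` f ` carrier G"
  proof
    fix C assume "C \<in> rcosets H"
    then obtain x where x: "x \<in> carrier G" "C = H #> x"
      by (auto simp: RCOSETS_def)
    define y where "y = (SOME y. y \<in> carrier G \<and> f y = f x)"
    have "y \<in> carrier G \<and> f y = f x"
      unfolding y_def by (rule someI[of _ x]) (use x in auto)
    then have "C = H #> y"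
      using coset x by metis
    then show "C \<in> (\<lambda>s. H #> (SOME x. x \<in> carrier G \<and> f x = s)) ` f ` carrier G"
      using x(1) unfolding y_def by blast
  qed
  then have "finite (rcosets H)"
    using fin by (meson finite_imageI finite_subset)
  then show ?thesis
    using H by (simp add: finite_index_def)
qed

lemma kernel_finite_index:
  assumes "group H" "finite (carrier H)" "h \<in> hom G H"
  shows "kernel G H h \<lhd> G" "finite_index (kernel G H h) G"
proof -
  interpret h: group_hom G H h
    using assms by (simp add: group_hom_def group_hom_axioms_def)
  show "kernel G H h \<lhd> G"
    by (rule h.normal_kernel)
  have "finite (h ` carrier G)"
    using assms(2) by (rule finite_subset[rotated]) auto
  then show "finite_index (kernel G H h) G"
    by (rule finite_indexI[OF h.subgroup_kernel]) (auto simp: kernel_def)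
qed

end

text \<open>The conjugator may depend on \<open>M\<close>; \<open>N\<close> only records where it
  can be found. \<open>N\<close> is an arbitrary set because cosets of a subgroup occur in this
  place as well.\<close>

definition approx_inner :: "('a, 'b) monoid_scheme \<Rightarrow> 'a set \<Rightarrow> ('a \<Rightarrow> 'a) \<Rightarrow> bool" where
  "approx_inner G N \<psi> \<longleftrightarrow> \<psi> \<in> hom G G \<and>
     (\<forall>M. M \<lhd> G \<longrightarrow> finite_index M G \<longrightarrow>
       (\<exists>n\<in>N. \<forall>x\<in>carrier G. \<psi> x \<in> M #>\<^bsub>G\<^esub> (n \<otimes>\<^bsub>G\<^esub> x \<otimes>\<^bsub>G\<^esub> inv\<^bsub>G\<^esub> n)))"

section \<open>Approximate conjugations and finite quotients\<close>

context group
begin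

lemma approx_inner_conj:
  assumes \<psi>: "approx_inner G N \<psi>" and N: "N \<subseteq> carrier G" and g: "g \<in> carrier G"
  shows "approx_inner G ((\<lambda>n. g \<otimes> n) ` N) (\<lambda>x. g \<otimes> \<psi> x \<otimes> inv g)"
  unfolding approx_inner_def
proof (intro conjI allI impI)
  have hom: "\<psi> \<in> hom G G"
    using \<psi> by (simp add: approx_inner_def)
  then have cl: "\<psi> x \<in> carrier G" if "x \<in> carrier G" for x
    using that by (auto simp: hom_def)
  show "(\<lambda>x. g \<otimes> \<psi> x \<otimes> inv g) \<in> hom G G"
    using hom g cl by (auto simp: hom_def m_assoc)
  fix M assume M: "M \<lhd> G" "finite_index M G"
  then obtain n where n: "n \<in> N" "\<And>x. x \<in> carrier G \<Longrightarrow> \<psi> x \<in> M #> (n \<otimes> x \<otimes> inv n)"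
    using \<psi> unfolding approx_inner_def by blast
  show "\<exists>n\<in>(\<lambda>n. g \<otimes> n) ` N. \<forall>x\<in>carrier G. g \<otimes> \<psi> x \<otimes> inv g \<in> M #> (n \<otimes> x \<otimes> inv n)"
  proof (intro bexI ballI)
    fix x assume x: "x \<in> carrier G"
    obtain m where m: "m \<in> M" "\<psi> x = m \<otimes> (n \<otimes> x \<otimes> inv n)"
      using n(2)[OF x] by (auto simp: r_coset_def)
    have mG: "m \<in> carrier G" "n \<in> carrier G"
      using m(1) M(1) n(1) N normal_imp_subgroup subgroup.subset by blast+
    have "g \<otimes> m \<otimes> inv g \<in> M"
      using M(1) g m(1) by (simp add: normal_inv_iff)
    moreover have "g \<otimes> \<psi> x \<otimes> inv g = (g \<otimes> m \<otimes> inv g) \<otimes> ((g \<otimes> n) \<otimes> x \<otimes> inv (g \<otimes> n))"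
      using m(2) mG g x by (simp add: m_assoc inv_mult_group)
    ultimately show "g \<otimes> \<psi> x \<otimes> inv g \<in> M #> ((g \<otimes> n) \<otimes> x \<otimes> inv (g \<otimes> n))"
      unfolding r_coset_def by blast
  qed (use n(1) in blast)
qed

lemma approx_inner_finite_image:
  assumes \<psi>: "approx_inner G N \<psi>" and N: "N \<subseteq> carrier G"
    and H: "group H" "finite (carrier H)" "h \<in> hom G H"
  obtains n where "n \<in> N" "\<And>x. x \<in> carrier G \<Longrightarrow> h (\<psi> x) = h (n \<otimes> x \<otimes> inv n)"
proof -
  interpret h: group_hom G H h
    using H by (simp add: group_hom_def group_hom_axioms_def)
  obtain n where n: "n \<in> N"
      "\<And>x. x \<in> carrier G \<Longrightarrow> \<psi> x \<in> kernel G H h #> (n \<otimes> x \<otimes> inv n)"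
    using \<psi> kernel_finite_index[OF H] unfolding approx_inner_def by blast
  have "h (\<psi> x) = h (n \<otimes> x \<otimes> inv n)" if "x \<in> carrier G" for x
  proof -
    have "n \<in> carrier G"
      using n(1) N by blast
    then show ?thesis
      using n(2)[OF that] that by (auto simp: r_coset_def kernel_def)
  qed
  then show ?thesis
    using that n(1) by blast
qed

text \<open>In the finite action built from \<open>w\<close>, the permutation of \<open>z\<close> is
  conjugate to that of \<open>\<psi> z\<close>, hence to that of \<open>w\<close>, and inherits a
  fixed point. Basis elements have none, nor has \<open>a \<otimes> x\<close> when the cycle is long
  enough.\<close>

lemma approx_inner_fixpoint:
  assumes B: "free_basis G B" and \<psi>: "approx_inner G (carrier G) \<psi>"
    and w: "reduced_word (w @ w)" "set w \<subseteq> B \<times> UNIV" "2 \<le> length w"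
    and z: "z \<in> carrier G" "u \<in> carrier G" "\<psi> z = u \<otimes> word_value G w \<otimes> inv u"
  shows "z \<notin> B" and "3 \<le> length w \<Longrightarrow> a \<in> B \<Longrightarrow> x \<in> B \<Longrightarrow> x \<noteq> a \<Longrightarrow> z \<noteq> a \<otimes> x"
proof -
  obtain X :: "(nat \<times> bool \<times> bool) set" and h where X: "finite X" and h: "h \<in> hom G (perm_group X)"
    and p: "\<exists>p\<in>X. h (word_value G w) p = p"
    and no_fix: "\<And>x p. x \<in> B \<Longrightarrow> p \<in> X \<Longrightarrow> h x p \<noteq> p"
    and no_fix2: "\<And>x p. 3 \<le> length w \<Longrightarrow> a \<in> B \<Longrightarrow> x \<in> B \<Longrightarrow> x \<noteq> a \<Longrightarrow> p \<in> X \<Longrightarrow> h (a \<otimes> x) p \<noteq> p"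
    using cycle_action[OF B w, of a] by blast
  interpret h: group_hom G "perm_group X" h
    using h by (simp add: group_hom_def group_hom_axioms_def group_perm_group is_group)
  obtain n where n: "n \<in> carrier G" "h (\<psi> z) = h (n \<otimes> z \<otimes> inv n)"
    using approx_inner_finite_image[OF \<psi> _ group_perm_group _ h] X z(1)
    by (auto simp: finite_permutations)
  have wG: "word_value G w \<in> carrier G"
    using free_basis_words[OF B w(2)] by simp
  \<comment> \<open>\<open>h g\<close> conjugates the permutation of \<open>w\<close> to that of
    \<open>z\<close> and so carries fixed points of the former to fixed points of the
    latter.\<close>
  define g where "g = inv n \<otimes> u"
  have g: "g \<in> carrier G"
    using n z by (simp add: g_def)
  have perm: "h g permutes X"
    using h.hom_closed[OF g] by simp
  have conj: "h (inv n \<otimes> y \<otimes> n) = h (inv n) \<circ> h y \<circ> h n" if "y \<in> carrier G" for y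
    using n(1) that by (simp only: h.hom_mult perm_group_simps m_closed inv_closed)
  have "h z = h (inv n \<otimes> (n \<otimes> z \<otimes> inv n) \<otimes> n)"
    using n(1) z(1) by (simp add: m_assoc)
  also have "\<dots> = h (inv n) \<circ> h (n \<otimes> z \<otimes> inv n) \<circ> h n"
    by (rule conj) (use n(1) z(1) in simp)
  also have "h (n \<otimes> z \<otimes> inv n) = h (u \<otimes> word_value G w \<otimes> inv u)"
    by (simp only: n(2)[symmetric] z(3))
  also have "h (inv n) \<circ> h (u \<otimes> word_value G w \<otimes> inv u) \<circ> h n =
      h (inv n \<otimes> (u \<otimes> word_value G w \<otimes> inv u) \<otimes> n)"
    by (rule conj[symmetric]) (use z(2) wG in simp)
  also have "inv n \<otimes> (u \<otimes> word_value G w \<otimes> inv u) \<otimes> n = g \<otimes> word_value G w \<otimes> inv g"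
    using n(1) z(2) wG by (simp add: m_assoc g_def inv_mult_group)
  also have "h (g \<otimes> word_value G w \<otimes> inv g) = h g \<circ> h (word_value G w) \<circ> Hilbert_Choice.inv (h g)"
    using g wG perm by simp
  finally have hz: "h z = h g \<circ> h (word_value G w) \<circ> Hilbert_Choice.inv (h g)" .
  obtain p where "p \<in> X" "h (word_value G w) p = p"
    using p by blast
  then have fixed: "h g p \<in> X" "h z (h g p) = h g p"
    using perm by (simp_all add: hz permutes_in_image permutes_inverses)
  show "z \<notin> B"
    using no_fix fixed by blast
  show "z \<noteq> a \<otimes> x" if "3 \<le> length w" "a \<in> B" "x \<in> B" "x \<noteq> a"
    using no_fix2[OF that] fixed by blast
qed

end

section \<open>Images of basis elements\<close>

context group
begin

text \<open>Conjugations become trivial in a commutative group.\<close>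

lemma approx_inner_image_comm:
  assumes \<psi>: "approx_inner G N \<psi>" and N: "N \<subseteq> carrier G"
    and H: "comm_group H" "finite (carrier H)" "h \<in> hom G H" and x: "x \<in> carrier G"
  shows "h (\<psi> x) = h x"
proof -
  interpret H: comm_group H by fact
  interpret h: group_hom G H h
    using H by (simp add: group_hom_def group_hom_axioms_def H.is_group)
  obtain n where n: "n \<in> N" "h (\<psi> x) = h (n \<otimes> x \<otimes> inv n)"
    using approx_inner_finite_image[OF \<psi> N H.is_group H(2,3)] x by blast
  have nG: "n \<in> carrier G"
    using n(1) N by blast
  then have "h (n \<otimes> x \<otimes> inv n) = h n \<otimes>\<^bsub>H\<^esub> h x \<otimes>\<^bsub>H\<^esub> inv\<^bsub>H\<^esub> h n"
    using x by simp
  also have "\<dots> = h x"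
    using nG x by (simp add: H.m_comm[of "h n"] H.m_assoc)
  finally show ?thesis
    using n(2) by simp
qed

text \<open>The fixed-point argument leaves only cyclically reduced words of length at most one.
  Among these, the exponent of \<open>a\<close> modulo 3 singles out the letter \<open>a\<close>
  itself.\<close>

lemma approx_inner_basis:
  assumes B: "free_basis G B" and \<psi>: "approx_inner G (carrier G) \<psi>" and a: "a \<in> B"
  obtains u where "u \<in> carrier G" "\<psi> a = u \<otimes> a \<otimes> inv u"
proof -
  have aG: "a \<in> carrier G"
    using a free_basis_subset[OF B] by blast
  have "\<psi> a \<in> carrier G"
    using \<psi> aG by (auto simp: approx_inner_def hom_def)
  then obtain u w where uw: "u \<in> carrier G" "set w \<subseteq> B \<times> UNIV" "reduced_word (w @ w)"
      "\<psi> a = u \<otimes> word_value G w \<otimes> inv u"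
    by (rule free_basis_conj_cyclically_reduced[OF B])
  have short: "length w < 2"
    using approx_inner_fixpoint(1)[OF B \<psi> uw(3,2) _ aG uw(1,4)] a by force
  \<comment> \<open>Modulo 3, unlike modulo 2, the exponent distinguishes \<open>a\<close> from
    \<open>inv a\<close>.\<close>
  let ?Z = "integer_mod_group 3"
  have Z: "comm_group ?Z" "finite (carrier ?Z)" "group ?Z"
    by (simp_all add: carrier_integer_mod_group)
  interpret Z: comm_group ?Z by (rule Z)
  have "(\<lambda>x. if x = a then 1 else 0) \<in> B \<rightarrow> carrier ?Z"
    by (auto simp: carrier_integer_mod_group)
  from free_basis_universal[OF B Z(3) this] obtain h where h: "h \<in> hom G ?Z"
      and hB: "\<And>x. x \<in> B \<Longrightarrow> h x = (if x = a then 1 else 0)"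
    by metis
  interpret h: group_hom G ?Z h
    using h by (simp add: group_hom_def group_hom_axioms_def)
  have wG: "word_value G w \<in> carrier G"
    using free_basis_words[OF B uw(2)] by simp
  have "h (word_value G w) = h (u \<otimes> word_value G w \<otimes> inv u)"
    using uw(1) wG Z.m_comm[of "h u" "h (word_value G w)"]
    by (simp add: Z.m_assoc del: mult_integer_mod_group inv_integer_mod_group)
  also have "\<dots> = 1"
    using approx_inner_image_comm[OF \<psi> _ Z(1,2) h aG] hB[OF a] uw(4) by simp
  finally have hw: "h (word_value G w) = 1" .
  consider "w = []" | b s where "w = [(b, s)]" "b \<in> B"
    using short uw(2) by (cases w; cases "tl w") auto
  then have "w = [(a, True)]"
  proof cases
    case 1
    then show ?thesis
      using hw h.hom_one by simp
  next
    case (2 b s)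
    then have "b \<in> carrier G"
      using free_basis_subset[OF B] by blast
    then show ?thesis
      using hw 2 hB[OF 2(2)] inv_integer_mod_group
      by (cases "b = a"; cases s) (auto simp: carrier_integer_mod_group)
  qed
  then show ?thesis
    using that[OF uw(1)] uw(4) aG by simp
qed

text \<open>The image of \<open>a \<otimes> c\<close> is spelled by a, w, c and the inverse of w.
  The conditions on the ends of \<open>w\<close> make this word cyclically reduced, and it is long
  enough for an action in which \<open>a \<otimes> c\<close> has no fixed point.\<close>

lemma conj_basis_word_impossible:
  assumes B: "free_basis G B" and \<psi>: "approx_inner G (carrier G) \<psi>"
    and ac: "a \<in> B" "c \<in> B" "a \<noteq> c"
    and w: "set w \<subseteq> B \<times> UNIV" "reduced_word w" "w \<noteq> []" "fst (hd w) \<noteq> a" "fst (last w) \<noteq> c"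
    and fixa: "\<psi> a = a" and conjc: "\<psi> c = word_value G w \<otimes> c \<otimes> inv (word_value G w)"
  shows False
proof -
  define W where "W = (a, True) # w @ (c, True) # inverse_word w"
  have W: "set W \<subseteq> B \<times> UNIV"
    using ac w(1) set_inverse_word[OF w(1)] by (simp add: W_def)
  have "reduced_word (W @ W)"
    using w(2-5) ac
    by (auto simp: W_def reduced_word_append reduced_word_Cons reduced_inverse_word hd_inverse_word
        last_inverse_word hd_append cancels_def last_append)
  moreover have "3 \<le> length W"
    using w(3) by (cases w) (auto simp: W_def)
  moreover have G: "a \<in> carrier G" "c \<in> carrier G"
    using ac free_basis_subset[OF B] by auto
  moreover have wG: "set w \<subseteq> carrier G \<times> UNIV"
    by (rule free_basis_words[OF B w(1)])
  have "word_value G W = a \<otimes> (word_value G w \<otimes> (c \<otimes> inv (word_value G w)))"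
    using wG set_inverse_word[OF wG] G
    by (simp add: W_def word_value_append word_value_inverse_word)
  then have "\<psi> (a \<otimes> c) = \<one> \<otimes> word_value G W \<otimes> inv \<one>"
    using hom_mult[of \<psi> G G a c] \<psi> fixa conjc G wG by (simp add: approx_inner_def m_assoc)
  ultimately show False
    using approx_inner_fixpoint(2)[OF B \<psi> _ W, of "a \<otimes> c" \<one> a c] ac by auto
qed

lemma approx_inner_conj_carrier:
  assumes "approx_inner G (carrier G) \<psi>" "g \<in> carrier G"
  shows "approx_inner G (carrier G) (\<lambda>x. g \<otimes> \<psi> x \<otimes> inv g)"
proof -
  have "(\<lambda>n. g \<otimes> n) ` carrier G \<subseteq> carrier G"
    using assms(2) by auto
  then show ?thesis
    using approx_inner_conj[OF assms(1) _ assms(2)] unfolding approx_inner_def by blast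
qed

lemma conj_basis_power:
  assumes B: "free_basis G B" and \<psi>: "approx_inner G (carrier G) \<psi>"
    and ac: "a \<in> B" "c \<in> B" "a \<noteq> c"
    and w: "set w \<subseteq> B \<times> UNIV" "reduced_word w"
    and fixa: "\<psi> a = a" and conjc: "\<psi> c = word_value G w \<otimes> c \<otimes> inv (word_value G w)"
  shows "\<exists>k::int. \<psi> c = a [^] k \<otimes> c \<otimes> inv (a [^] k)"
  using \<psi> w fixa conjc
proof (induction w arbitrary: \<psi> rule: length_induct)
  case (1 w)
  have G: "a \<in> carrier G" "c \<in> carrier G"
    using ac free_basis_subset[OF B] by auto
  note wG = free_basis_words[OF B 1(3)]
  consider "w = []" | "w \<noteq> []" "fst (hd w) = a" | "w \<noteq> []" "fst (last w) = c"
    | "w \<noteq> []" "fst (hd w) \<noteq> a" "fst (last w) \<noteq> c"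
    by blast
  then show ?case
  proof cases
    case 1
    then show ?thesis
      using \<open>\<psi> c = _\<close> G by (intro exI[of _ 0]) simp
  next
    case 2
    then obtain s v where w: "w = (a, s) # v"
      by (cases w) auto
    define e :: int where "e = (if s then 1 else - 1)"
    have L: "word_value G w = a [^] e \<otimes> word_value G v" "word_value G v \<in> carrier G"
      using G wG by (auto simp: w e_def int_pow_neg int_pow_1)
    \<comment> \<open>Peeling off the initial letter changes the homomorphism; the induction
      hypothesis is applied to \<open>\<psi>'\<close> and the shorter word \<open>v\<close>.\<close>
    define \<psi>' where "\<psi>' x = inv (a [^] e) \<otimes> \<psi> x \<otimes> inv (inv (a [^] e))" for x
    have "approx_inner G (carrier G) \<psi>'"
      unfolding \<psi>'_def using 1(2) G by (intro approx_inner_conj_carrier) auto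
    moreover have "a \<otimes> a [^] e = a [^] e \<otimes> a"
      using G int_pow_mult[of a 1 e] int_pow_mult[of a e 1] by (simp add: int_pow_1 add.commute)
    then have "\<psi>' a = a"
      using G 1(5) by (simp add: \<psi>'_def m_assoc)
    moreover have "\<psi>' c = word_value G v \<otimes> c \<otimes> inv (word_value G v)"
      using G 1(6) L by (simp add: \<psi>'_def m_assoc inv_mult_group)
    moreover have "length v < length w" "set v \<subseteq> B \<times> UNIV" "reduced_word v"
      using 1(3,4) by (auto simp: w reduced_word_Cons)
    ultimately obtain k :: int where k: "\<psi>' c = a [^] k \<otimes> c \<otimes> inv (a [^] k)"
      using 1(1) by blast
    have "\<psi> c \<in> carrier G"
      using 1(6) G wG by simp
    then have "\<psi> c = a [^] e \<otimes> \<psi>' c \<otimes> inv (a [^] e)"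
      using G by (simp add: \<psi>'_def m_assoc)
    also have "\<dots> = a [^] (e + k) \<otimes> c \<otimes> inv (a [^] (e + k))"
      using G by (simp add: k int_pow_mult m_assoc inv_mult_group)
    finally show ?thesis
      by blast
  next
    case 3
    then obtain s v where w: "w = v @ [(c, s)]"
      by (cases w rule: rev_cases) auto
    have v: "length v < length w" "set v \<subseteq> B \<times> UNIV" "reduced_word v"
      using 1(3,4) by (auto simp: w reduced_word_append)
    have "word_value G w = word_value G v \<otimes> word_value G [(c, s)]" "word_value G v \<in> carrier G"
      using wG unfolding w by (intro word_value_append word_value_closed; auto)+
    then have "\<psi> c = word_value G v \<otimes> c \<otimes> inv (word_value G v)"
      using 1(6) G by (cases s) (auto simp: m_assoc inv_mult_group)
    then show ?thesis
      using 1(1,2,5) v by blast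
  next
    case 4
    then show ?thesis
      using conj_basis_word_impossible[OF B 1(2) ac 1(3,4) _ _ _ 1(5,6)] by blast
  qed
qed

section \<open>From two basis elements to the whole basis\<close>

lemma word_value_replicate:
  assumes "x \<in> carrier G"
  shows "word_value G (replicate (nat \<bar>k\<bar>) (x, k \<ge> 0)) = x [^] (k::int)"
proof -
  have pos: "word_value G (replicate n (x, True)) = x [^] n" for n
    using assms by (induction n) (auto simp: nat_pow_Suc2[symmetric])
  have neg: "word_value G (replicate n (x, False)) = inv x [^] n" for n
    using assms by (induction n) (auto simp: nat_pow_Suc2[symmetric])
  show ?thesis
    by (subst int_pow_def2) (simp add: pos neg nat_pow_inv int_pow_inv assms)
qed

lemma reduced_word_replicate: "reduced_word (replicate n l)"
  by (induction n) (auto simp: reduced_word_Cons cancels_def)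

text \<open>Because \<open>a\<close> is fixed, \<open>c\<close> is conjugated by a power of
  \<open>a\<close>. A nontrivial power neither starts with \<open>b\<close> nor ends with
  \<open>c\<close>, so the second fixed element \<open>b\<close> rules it out.\<close>

lemma approx_inner_fix_two:
  assumes B: "free_basis G B" and \<psi>: "approx_inner G (carrier G) \<psi>"
    and ab: "a \<in> B" "b \<in> B" "a \<noteq> b" "\<psi> a = a" "\<psi> b = b" and c: "c \<in> B"
  shows "\<psi> c = c"
proof (cases "c = a \<or> c = b")
  case False
  have G: "a \<in> carrier G" "c \<in> carrier G"
    using ab c free_basis_subset[OF B] by auto
  obtain u where u: "u \<in> carrier G" "\<psi> c = u \<otimes> c \<otimes> inv u"
    using approx_inner_basis[OF B \<psi> c] .
  obtain v where v: "set v \<subseteq> B \<times> UNIV" "reduced_word v" "word_value G v = u"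
    using free_basis_obtain_word[OF B u(1)] .
  obtain k :: int where k: "\<psi> c = a [^] k \<otimes> c \<otimes> inv (a [^] k)"
    using conj_basis_power[OF B \<psi> ab(1) c _ v(1,2) ab(4)] u(2) v(3) False by blast
  have "k = 0"
  proof (rule ccontr)
    assume "k \<noteq> 0"
    define w where "w = replicate (nat \<bar>k\<bar>) (a, k \<ge> 0)"
    have w: "set w \<subseteq> B \<times> UNIV" "reduced_word w" "w \<noteq> []" "fst (hd w) \<noteq> b" "fst (last w) \<noteq> c"
      using ab False \<open>k \<noteq> 0\<close> by (auto simp: w_def reduced_word_replicate)
    have "\<psi> c = word_value G w \<otimes> c \<otimes> inv (word_value G w)"
      using k word_value_replicate[OF G(1), of k] by (simp add: w_def)
    then show False
      using conj_basis_word_impossible[OF B \<psi> ab(2) c _ w ab(5)] False by blast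
  qed
  then show ?thesis
    using k G by simp
qed (use ab in auto)

text \<open>One conjugation makes \<open>\<psi>\<close> fix \<open>a\<close>, another by a power of
  \<open>a\<close> makes it fix \<open>b\<close> too, and then it fixes the whole basis.\<close>

theorem approx_inner_free_group:
  assumes B: "free_basis G B" and \<psi>: "approx_inner G (carrier G) \<psi>"
  obtains g where "g \<in> carrier G" "\<And>x. x \<in> carrier G \<Longrightarrow> \<psi> x = g \<otimes> x \<otimes> inv g"
proof -
  note BG = free_basis_subset[OF B]
  have "\<exists>g\<in>carrier G. \<forall>x\<in>B. \<psi> x = g \<otimes> x \<otimes> inv g"
  proof (cases "B = {}")
    case False
    then obtain a where a: "a \<in> B" "a \<in> carrier G"
      using BG by blast
    obtain u where u: "u \<in> carrier G" "\<psi> a = u \<otimes> a \<otimes> inv u"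
      using approx_inner_basis[OF B \<psi> a(1)] .
    show ?thesis
    proof (cases "B = {a}")
      case True
      then show ?thesis
        using u by blast
    next
      case False
      then obtain b where b: "b \<in> B" "b \<noteq> a"
        using a by blast
      have cl: "\<psi> x \<in> carrier G" if "x \<in> carrier G" for x
        using \<psi> that by (auto simp: approx_inner_def hom_def)
      define \<psi>1 where "\<psi>1 x = inv u \<otimes> \<psi> x \<otimes> inv (inv u)" for x
      have \<psi>1: "approx_inner G (carrier G) \<psi>1"
        unfolding \<psi>1_def using u(1) by (intro approx_inner_conj_carrier[OF \<psi>] inv_closed)
      have \<psi>1a: "\<psi>1 a = a"
        using u a by (simp add: \<psi>1_def m_assoc)
      obtain v' where v': "v' \<in> carrier G" "\<psi>1 b = v' \<otimes> b \<otimes> inv v'"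
        using approx_inner_basis[OF B \<psi>1 b(1)] .
      obtain v where v: "set v \<subseteq> B \<times> UNIV" "reduced_word v" "word_value G v = v'"
        using free_basis_obtain_word[OF B v'(1)] .
      obtain k :: int where k: "\<psi>1 b = a [^] k \<otimes> b \<otimes> inv (a [^] k)"
        using conj_basis_power[OF B \<psi>1 a(1) b(1) _ v(1,2) \<psi>1a] v'(2) v(3) b(2) by blast
      define p where "p = a [^] k"
      have p: "p \<in> carrier G" "a \<otimes> p = p \<otimes> a"
        using a int_pow_mult[of a 1 k] int_pow_mult[of a k 1]
        by (simp_all add: p_def int_pow_1 add.commute)
      \<comment> \<open>\<open>p\<close> commutes with \<open>a\<close>, so the second correction
        leaves \<open>a\<close> fixed.\<close>
      define \<psi>2 where "\<psi>2 x = inv p \<otimes> \<psi>1 x \<otimes> inv (inv p)" for x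
      have bG: "b \<in> carrier G"
        using b BG by blast
      have "approx_inner G (carrier G) \<psi>2"
        unfolding \<psi>2_def by (intro approx_inner_conj_carrier[OF \<psi>1] inv_closed p)
      moreover have "\<psi>2 a = a" "\<psi>2 b = b"
        using p a \<psi>1a k bG by (simp_all add: \<psi>2_def m_assoc p_def[symmetric])
      ultimately have "\<psi>2 x = x" if "x \<in> B" for x
        using approx_inner_fix_two[OF B _ a(1) b(1)] b(2) that by blast
      moreover have "\<psi> x = (u \<otimes> p) \<otimes> \<psi>2 x \<otimes> inv (u \<otimes> p)" if "x \<in> carrier G" for x
        using u(1) p(1) cl[OF that] by (simp add: \<psi>2_def \<psi>1_def m_assoc inv_mult_group)
      ultimately show ?thesis
        using u(1) p(1) BG by (intro bexI[of _ "u \<otimes> p"]) auto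
    qed
  qed auto
  then obtain g where g: "g \<in> carrier G" "\<And>x. x \<in> B \<Longrightarrow> \<psi> x = g \<otimes> x \<otimes> inv g"
    by blast
  have "(\<lambda>x. g \<otimes> x \<otimes> inv g) \<in> hom G G"
    using g(1) by (auto simp: hom_def m_assoc)
  then have "\<psi> x = g \<otimes> x \<otimes> inv g" if "x \<in> carrier G" for x
    using hom_eq_on_basis[OF B is_group, of \<psi> "\<lambda>x. g \<otimes> x \<otimes> inv g" x] g(2) that \<psi>
    by (simp add: approx_inner_def)
  then show ?thesis
    using that g(1) by blast
qed

text \<open>If a central element has the nonempty reduced word \<open>w\<close>, then
  \<open>l # w\<close> and \<open>w @ [l]\<close> have equal values for every letter
  \<open>l\<close>; a suitable \<open>l\<close> makes them reduced and different.\<close>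

lemma free_group_center_trivial:
  assumes B: "free_basis G B" and ab: "a \<in> B" "b \<in> B" "a \<noteq> b"
    and z: "z \<in> carrier G" "\<And>x. x \<in> B \<Longrightarrow> z \<otimes> x = x \<otimes> z"
  shows "z = \<one>"
proof -
  obtain w where w: "set w \<subseteq> B \<times> UNIV" "reduced_word w" "word_value G w = z"
    using free_basis_obtain_word[OF B z(1)] .
  note wG = free_basis_words[OF B w(1)]
  have "w = []"
  proof (rule ccontr)
    assume "w \<noteq> []"
    \<comment> \<open>The generator \<open>d\<close> differs from that of the first letter, and the
      sign is copied from the last letter; so \<open>l\<close> cancels at neither end, even if the
      last letter also involves \<open>d\<close>.\<close>
    define d where "d = (if fst (hd w) = a then b else a)"
    define l where "l = (d, snd (last w))"
    have d: "d \<in> B" "d \<in> carrier G" "d \<noteq> fst (hd w)"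
      using ab free_basis_subset[OF B] by (auto simp: d_def)
    have "word_value G [l] = (if snd l then d else inv d)"
      using d by (simp add: l_def)
    moreover have "z \<otimes> inv d = inv d \<otimes> z"
      using z(2)[OF d(1)] d(2) z(1) by (metis inv_closed inv_mult_cancel(1) m_assoc m_closed r_inv r_one)
    ultimately have "word_value G (l # w) = word_value G (w @ [l])"
      using wG w(3) d z by (subst word_value_append) (auto simp: l_def)
    moreover have "reduced_word (l # w)" "reduced_word (w @ [l])"
      using w(2) d \<open>w \<noteq> []\<close> by (auto simp: reduced_word_Cons reduced_word_append l_def cancels_def)
    ultimately have "l # w = w @ [l]"
      using free_basis_reduced_unique[OF B, of "l # w" "w @ [l]"] w(1) d(1) by (simp add: l_def)
    then have "hd w = l"
      using \<open>w \<noteq> []\<close> by (metis hd_append2 list.sel(1))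
    then show False
      using d(3) by (simp add: l_def)
  qed
  then show ?thesis
    using w(3) by simp
qed

end

section \<open>Subgroups of finite index\<close>

context group
begin

lemma rcos_eq_imp_mem:
  assumes "subgroup H G" "x \<in> carrier G" "y \<in> carrier G" "H #> x = H #> y"
  shows "x \<otimes> inv y \<in> H"
proof -
  obtain h where "h \<in> H" "x = h \<otimes> y"
    using rcos_self[OF assms(2,1)] assms(4) by (auto simp: r_coset_def)
  moreover from this have "h \<in> carrier G"
    using assms(1) subgroup.subset by blast
  ultimately show ?thesis
    using assms(3) by (simp add: m_assoc)
qed

lemma finite_index_Int:
  assumes "finite_index H G" "finite_index K G"
  shows "finite_index (H \<inter> K) G"
proof (rule finite_indexI[where f = "\<lambda>x. (H #> x, K #> x)"])
  have HK: "subgroup H G" "subgroup K G" "finite (rcosets H)" "finite (rcosets K)"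
    using assms by (auto simp: finite_index_def)
  show "subgroup (H \<inter> K) G"
    using HK by (simp add: subgroups_Inter_pair)
  show "finite ((\<lambda>x. (H #> x, K #> x)) ` carrier G)"
    by (rule finite_subset[OF _ finite_cartesian_product[OF HK(3,4)]]) (auto simp: RCOSETS_def)
  show "x \<otimes> inv y \<in> H \<inter> K"
    if "x \<in> carrier G" "y \<in> carrier G" "(H #> x, K #> x) = (H #> y, K #> y)" for x y
    using that rcos_eq_imp_mem[OF HK(1)] rcos_eq_imp_mem[OF HK(2)] by simp
qed

lemma normal_Int:
  assumes "H \<lhd> G" "K \<lhd> G"
  shows "H \<inter> K \<lhd> G"
  using assms by (auto simp: normal_inv_iff subgroups_Inter_pair)

lemma finite_index_carrier: "finite_index (carrier G) G"
  by (rule finite_indexI[where f = "\<lambda>_. ()"]) (auto simp: subgroup_self)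

lemma carrier_normal: "carrier G \<lhd> G"
  by (auto simp: normal_inv_iff subgroup_self)

text \<open>\<open>M\<close> is the normal core of \<open>H\<close>, the kernel of the action on the
  finitely many right cosets.\<close>

lemma finite_index_core:
  assumes "finite_index H G"
  obtains M where "M \<lhd> G" "finite_index M G" "M \<subseteq> H"
proof -
  have H: "subgroup H G" "finite (rcosets H)"
    using assms by (auto simp: finite_index_def)
  define M where "M = {x \<in> carrier G. \<forall>g\<in>carrier G. g \<otimes> x \<otimes> inv g \<in> H}"
  have sub: "subgroup M G"
  proof (rule subgroupI)
    show "M \<noteq> {}"
      using H(1) by (auto simp: M_def subgroup.one_closed intro!: exI[of _ \<one>])
    show "inv x \<in> M" if "x \<in> M" for x
    proof -
      have "g \<otimes> inv x \<otimes> inv g \<in> H" if "g \<in> carrier G" for g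
      proof -
        have "inv (g \<otimes> x \<otimes> inv g) \<in> H"
          using that \<open>x \<in> M\<close> H(1) by (auto simp: M_def subgroup.m_inv_closed)
        then show ?thesis
          using that \<open>x \<in> M\<close> by (simp add: M_def m_assoc inv_mult_group)
      qed
      then show ?thesis
        using that by (simp add: M_def)
    qed
    show "x \<otimes> y \<in> M" if "x \<in> M" "y \<in> M" for x y
    proof -
      have "g \<otimes> (x \<otimes> y) \<otimes> inv g \<in> H" if "g \<in> carrier G" for g
      proof -
        have "(g \<otimes> x \<otimes> inv g) \<otimes> (g \<otimes> y \<otimes> inv g) \<in> H"
          using that \<open>x \<in> M\<close> \<open>y \<in> M\<close> H(1) by (auto simp: M_def subgroup.m_closed)
        then show ?thesis
          using that \<open>x \<in> M\<close> \<open>y \<in> M\<close> by (simp add: M_def m_assoc)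
      qed
      then show ?thesis
        using that by (simp add: M_def)
    qed
  qed (auto simp: M_def)
  have "M \<lhd> G"
    unfolding normal_inv_iff
  proof (intro conjI ballI sub)
    fix x h assume "x \<in> carrier G" "h \<in> M"
    moreover have "g \<otimes> (x \<otimes> h \<otimes> inv x) \<otimes> inv g = (g \<otimes> x) \<otimes> h \<otimes> inv (g \<otimes> x)"
      if "g \<in> carrier G" for g
      using that \<open>x \<in> carrier G\<close> \<open>h \<in> M\<close> by (simp add: M_def m_assoc inv_mult_group)
    ultimately show "x \<otimes> h \<otimes> inv x \<in> M"
      by (simp add: M_def)
  qed
  \<comment> \<open>The invariant of \<open>x\<close> is its right multiplication on cosets, an
    element of a finite function space. Evaluating two equal invariants at the coset of
    \<open>g\<close> gives the membership condition for the conjugate by \<open>g\<close>.\<close>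
  moreover have "finite_index M G"
  proof (rule finite_indexI[OF sub, where f = "\<lambda>x. \<lambda>C\<in>rcosets H. C #> x"])
    have "(\<lambda>C\<in>rcosets H. C #> x) \<in> rcosets H \<rightarrow>\<^sub>E rcosets H" if "x \<in> carrier G" for x
      using that subgroup.subset[OF H(1)] by (auto simp: RCOSETS_def coset_mult_assoc)
    then have "(\<lambda>x. \<lambda>C\<in>rcosets H. C #> x) ` carrier G \<subseteq> (rcosets H \<rightarrow>\<^sub>E rcosets H)"
      by blast
    then show "finite ((\<lambda>x. \<lambda>C\<in>rcosets H. C #> x) ` carrier G)"
      by (rule finite_subset) (intro finite_PiE H(2))
  next
    fix x y assume xy: "x \<in> carrier G" "y \<in> carrier G"
      "(\<lambda>C\<in>rcosets H. C #> x) = (\<lambda>C\<in>rcosets H. C #> y)"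
    have "g \<otimes> (x \<otimes> inv y) \<otimes> inv g \<in> H" if g: "g \<in> carrier G" for g
    proof -
      have "H #> g \<in> rcosets H"
        using g subgroup.subset[OF H(1)] by (simp add: rcosetsI)
      then have "H #> g #> x = H #> g #> y"
        using fun_cong[OF xy(3), of "H #> g"] by simp
      then have "(g \<otimes> x) \<otimes> inv (g \<otimes> y) \<in> H"
        using g xy subgroup.subset[OF H(1)]
        by (intro rcos_eq_imp_mem[OF H(1)]) (simp_all add: coset_mult_assoc)
      then show ?thesis
        using g xy by (simp add: m_assoc inv_mult_group)
    qed
    then show "x \<otimes> inv y \<in> M"
      using xy by (simp add: M_def)
  qed
  moreover have "M \<subseteq> H"
    by (force simp: M_def dest: bspec[of _ _ \<one>])
  ultimately show ?thesis
    using that by blast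
qed

lemma finite_index_trans:
  assumes N: "finite_index N G" and M: "finite_index M (G\<lparr>carrier := N\<rparr>)"
  shows "finite_index M G"
proof -
  have subN: "subgroup N G" "finite (rcosets N)"
    and subM: "subgroup M (G\<lparr>carrier := N\<rparr>)" "finite (rcosets\<^bsub>G\<lparr>carrier := N\<rparr>\<^esub> M)"
    using N M by (auto simp: finite_index_def)
  have M_G: "subgroup M G"
    by (rule incl_subgroup[OF subN(1) subM(1)])
  \<comment> \<open>\<open>t\<close> picks a representative of each coset of \<open>N\<close>.
    Dividing \<open>x\<close> by it gives an element of \<open>N\<close>, whose coset of
    \<open>M\<close> completes the invariant of \<open>x\<close>.\<close>
  define t where "t C = (SOME y. y \<in> C)" for C :: "'a set"
  have t: "t (N #> x) \<in> carrier G" "x \<otimes> inv (t (N #> x)) \<in> N" if x: "x \<in> carrier G" for x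
  proof -
    have "t (N #> x) \<in> N #> x"
      unfolding t_def by (rule someI[of _ x]) (rule rcos_self[OF x subN(1)])
    moreover from this show cl: "t (N #> x) \<in> carrier G"
      using r_coset_subset_G[OF subgroup.subset[OF subN(1)] x] by blast
    ultimately have "N #> x = N #> t (N #> x)"
      using x subN(1) by (intro repr_independence)
    then show "x \<otimes> inv (t (N #> x)) \<in> N"
      using x cl by (intro rcos_eq_imp_mem[OF subN(1)])
  qed
  define f where "f x = (N #> x, M #> (x \<otimes> inv (t (N #> x))))" for x
  show ?thesis
  proof (rule finite_indexI[OF M_G, where f = f])
    have "f ` carrier G \<subseteq> (rcosets N) \<times> (rcosets\<^bsub>G\<lparr>carrier := N\<rparr>\<^esub> M)"
      using t(2) by (auto simp: f_def RCOSETS_def r_coset_def)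
    then show "finite (f ` carrier G)"
      by (rule finite_subset) (intro finite_cartesian_product subN(2) subM(2))
    fix x y assume xy: "x \<in> carrier G" "y \<in> carrier G" "f x = f y"
    define s where "s = t (N #> y)"
    have "N #> x = N #> y"
      using xy(3) by (simp add: f_def)
    then have "M #> (x \<otimes> inv s) = M #> (y \<otimes> inv s)" "s \<in> carrier G"
      using xy t(1) by (simp_all add: f_def s_def)
    then have "(x \<otimes> inv s) \<otimes> inv (y \<otimes> inv s) \<in> M"
      using xy by (intro rcos_eq_imp_mem[OF M_G]) auto
    then show "x \<otimes> inv y \<in> M"
      using xy \<open>s \<in> carrier G\<close> by (simp add: m_assoc inv_mult_group)
  qed
qed

text \<open>A compactness argument: if each coset failed for some normal subgroup, the intersection
  of these finitely many subgroups would still have a conjugator, and the coset containing it would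
  not fail.\<close>

lemma approx_inner_coset:
  assumes \<psi>: "approx_inner G (carrier G) \<psi>" and N: "finite_index N G"
  obtains C where "C \<in> rcosets N" "approx_inner G C \<psi>"
proof -
  have fin: "finite (rcosets N)" and subN: "subgroup N G"
    using N by (auto simp: finite_index_def)
  have hom: "\<psi> \<in> hom G G"
    using \<psi> by (simp add: approx_inner_def)
  have "\<exists>C\<in>rcosets N. approx_inner G C \<psi>"
  proof (rule ccontr)
    assume "\<not> ?thesis"
    then have "\<forall>C\<in>rcosets N. \<exists>M. M \<lhd> G \<and> finite_index M G \<and>
        \<not> (\<exists>n\<in>C. \<forall>x\<in>carrier G. \<psi> x \<in> M #> (n \<otimes> x \<otimes> inv n))"
      using hom unfolding approx_inner_def by blast
    then obtain M where M: "\<And>C. C \<in> rcosets N \<Longrightarrow> M C \<lhd> G \<and> finite_index (M C) G \<and>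
        \<not> (\<exists>n\<in>C. \<forall>x\<in>carrier G. \<psi> x \<in> M C #> (n \<otimes> x \<otimes> inv n))"
      by metis
    have "\<exists>K. K \<lhd> G \<and> finite_index K G \<and> (\<forall>C\<in>\<C>. K \<subseteq> M C)" if "\<C> \<subseteq> rcosets N" for \<C>
      using finite_subset[OF that fin] that
    proof (induction rule: finite_induct)
      case empty
      then show ?case
        using carrier_normal finite_index_carrier by blast
    next
      case (insert C \<C>)
      then obtain K where "K \<lhd> G" "finite_index K G" "\<forall>C\<in>\<C>. K \<subseteq> M C"
        by auto
      then show ?case
        using M[of C] insert.prems normal_Int finite_index_Int
        by (intro exI[of _ "K \<inter> M C"]) auto
    qed
    from this[OF order_refl] obtain K where K: "K \<lhd> G" "finite_index K G" "\<And>C. C \<in> rcosets N \<Longrightarrow> K \<subseteq> M C"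
      by blast
    then obtain n where n: "n \<in> carrier G" "\<And>x. x \<in> carrier G \<Longrightarrow> \<psi> x \<in> K #> (n \<otimes> x \<otimes> inv n)"
      using \<psi> unfolding approx_inner_def by blast
    have C: "N #> n \<in> rcosets N" "n \<in> N #> n"
      using n(1) subN by (simp_all add: rcosetsI subgroup.subset rcos_self)
    have "\<psi> x \<in> M (N #> n) #> (n \<otimes> x \<otimes> inv n)" if "x \<in> carrier G" for x
      using n(2)[OF that] K(3)[OF C(1)] by (auto simp: r_coset_def)
    then show False
      using M[OF C(1)] C(2) by blast
  qed
  then show ?thesis
    using that by blast
qed

lemma approx_inner_mono: "approx_inner G N \<psi> \<Longrightarrow> N \<subseteq> N' \<Longrightarrow> approx_inner G N' \<psi>"
  unfolding approx_inner_def by blast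

text \<open>All conjugators can be taken from one coset of \<open>N\<close>, and dividing by its
  representative \<open>c\<close> moves them into \<open>N\<close> by normality.\<close>

lemma approx_inner_shift:
  assumes \<psi>: "approx_inner G (carrier G) \<psi>" and N: "N \<lhd> G" "finite_index N G"
  obtains c where "c \<in> carrier G" "approx_inner G N (\<lambda>x. inv c \<otimes> \<psi> x \<otimes> inv (inv c))"
proof -
  obtain C where C: "C \<in> rcosets N" "approx_inner G C \<psi>"
    using approx_inner_coset[OF \<psi> N(2)] .
  then obtain c where c: "c \<in> carrier G" "C = N #> c"
    by (auto simp: RCOSETS_def)
  have NG: "N \<subseteq> carrier G"
    using N(1) normal_imp_subgroup subgroup.subset by blast
  have "(\<lambda>n. inv c \<otimes> n) ` C \<subseteq> N"
  proof clarify
    fix n assume "n \<in> C"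
    then obtain h where h: "h \<in> N" "n = h \<otimes> c"
      by (auto simp: c r_coset_def)
    have "inv c \<otimes> h \<otimes> inv (inv c) \<in> N"
      using N(1) c(1) h(1) unfolding normal_inv_iff by blast
    then show "inv c \<otimes> n \<in> N"
      using h c(1) NG by (auto simp: m_assoc)
  qed
  moreover have "C \<subseteq> carrier G"
    using c NG by (simp add: r_coset_subset_G)
  ultimately show ?thesis
    using that[OF c(1)] approx_inner_mono[OF approx_inner_conj[OF C(2) _ inv_closed[OF c(1)]]] by blast
qed

text \<open>Taking \<open>M = N\<close>: conjugation by an element of \<open>N\<close> is trivial
  modulo \<open>N\<close>.\<close>

lemma approx_inner_mod:
  assumes \<psi>: "approx_inner G N \<psi>" and N: "N \<lhd> G" "finite_index N G" and x: "x \<in> carrier G"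
  shows "\<psi> x \<otimes> inv x \<in> N"
proof -
  obtain n where n: "n \<in> N" "\<psi> x \<in> N #> (n \<otimes> x \<otimes> inv n)"
    using \<psi> N x unfolding approx_inner_def by blast
  then obtain m where m: "m \<in> N" "\<psi> x = m \<otimes> (n \<otimes> x \<otimes> inv n)"
    by (auto simp: r_coset_def)
  have sub: "subgroup N G"
    using N(1) by (rule normal_imp_subgroup)
  have G: "m \<in> carrier G" "n \<in> carrier G"
    using m n subgroup.subset[OF sub] by auto
  have "x \<otimes> inv n \<otimes> inv x \<in> N"
    using N(1) x subgroup.m_inv_closed[OF sub n(1)] unfolding normal_inv_iff by blast
  then have "m \<otimes> (n \<otimes> (x \<otimes> inv n \<otimes> inv x)) \<in> N"
    using m n subgroup.m_closed[OF sub] by blast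
  then show ?thesis
    using m(2) G x by (simp add: m_assoc)
qed

text \<open>A subgroup that is normal in \<open>N\<close> may fail to be normal in \<open>G\<close>;
  its core in \<open>G\<close> is used in its place.\<close>

lemma approx_inner_restrict:
  assumes \<psi>: "approx_inner G N \<psi>" and N: "N \<lhd> G" "finite_index N G"
  shows "approx_inner (G\<lparr>carrier := N\<rparr>) N \<psi>"
  unfolding approx_inner_def
proof (intro conjI allI impI)
  have sub: "subgroup N G"
    using N(1) by (rule normal_imp_subgroup)
  note NG = subgroup.mem_carrier[OF sub]
  have hom: "\<psi> \<in> hom G G"
    using \<psi> by (simp add: approx_inner_def)
  have "\<psi> x \<in> N" if "x \<in> N" for x
  proof -
    have "\<psi> x \<otimes> inv x \<otimes> x \<in> N"
      using approx_inner_mod[OF \<psi> N NG[OF that]] that by (rule subgroup.m_closed[OF sub])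
    then show ?thesis
      using hom NG[OF that] by (simp add: m_assoc hom_in_carrier)
  qed
  then show "\<psi> \<in> hom (G\<lparr>carrier := N\<rparr>) (G\<lparr>carrier := N\<rparr>)"
    using hom NG by (auto simp: hom_def)
  fix M assume "finite_index M (G\<lparr>carrier := N\<rparr>)"
  then obtain K where K: "K \<lhd> G" "finite_index K G" "K \<subseteq> M"
    using finite_index_core[OF finite_index_trans[OF N(2)]] by blast
  then obtain n where n: "n \<in> N" "\<And>x. x \<in> carrier G \<Longrightarrow> \<psi> x \<in> K #> (n \<otimes> x \<otimes> inv n)"
    using \<psi> unfolding approx_inner_def by blast
  show "\<exists>n\<in>N. \<forall>x\<in>carrier (G\<lparr>carrier := N\<rparr>). \<psi> x \<in> M #>\<^bsub>G\<lparr>carrier := N\<rparr>\<^esub>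
      (n \<otimes>\<^bsub>G\<lparr>carrier := N\<rparr>\<^esub> x \<otimes>\<^bsub>G\<lparr>carrier := N\<rparr>\<^esub> inv\<^bsub>G\<lparr>carrier := N\<rparr>\<^esub> n)"
  proof (intro bexI[OF _ n(1)] ballI)
    fix x assume "x \<in> carrier (G\<lparr>carrier := N\<rparr>)"
    then obtain k where "k \<in> K" "\<psi> x = k \<otimes> (n \<otimes> x \<otimes> inv n)"
      using n(2)[of x] NG by (auto simp: r_coset_def)
    then show "\<psi> x \<in> M #>\<^bsub>G\<lparr>carrier := N\<rparr>\<^esub>
        (n \<otimes>\<^bsub>G\<lparr>carrier := N\<rparr>\<^esub> x \<otimes>\<^bsub>G\<lparr>carrier := N\<rparr>\<^esub> inv\<^bsub>G\<lparr>carrier := N\<rparr>\<^esub> n)"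
      using K(3) m_inv_consistent[OF sub n(1)] by (auto simp: r_coset_def)
  qed
qed

end

section \<open>Free normal subgroups of finite index\<close>

context group
begin

text \<open>\<open>\<rho>\<close> is the exponent map, given by the universal property.\<close>

lemma free_basis_singleton:
  assumes B: "free_basis G {a}"
  obtains \<rho> :: "'a \<Rightarrow> int" where "\<rho> \<in> hom G integer_group" "\<rho> a = 1"
    "\<And>x. x \<in> carrier G \<Longrightarrow> x = a [^] \<rho> x"
proof -
  have a: "a \<in> carrier G"
    using free_basis_subset[OF B] by simp
  have "(\<lambda>_. 1) \<in> {a} \<rightarrow> carrier integer_group"
    by simp
  then obtain \<rho> where \<rho>: "\<rho> \<in> hom G integer_group" "\<rho> a = 1"
    using free_basis_universal[OF B group_integer_group] by (metis singletonI)
  have "(\<lambda>x. a [^] \<rho> x) \<in> hom G G"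
    using \<rho>(1) a by (auto simp: hom_def int_pow_mult)
  moreover have "(\<lambda>x. x) \<in> hom G G"
    by (simp add: hom_def)
  ultimately have "x = a [^] \<rho> x" if "x \<in> carrier G" for x
    using hom_eq_on_basis[OF B is_group, of "\<lambda>x. x" "\<lambda>x. a [^] \<rho> x" x] that \<rho>(2) a
    by (simp add: int_pow_1)
  then show ?thesis
    using that \<rho> by blast
qed

text \<open>Conjugation acts on the cyclic group \<open>N\<close> by signs \<open>\<epsilon>\<close>, and \<open>\<psi> x \<otimes> inv x\<close> is an element of \<open>N\<close>
  that agrees modulo every \<open>m\<close> with \<open>1 - \<epsilon> x\<close> times an integer depending on \<open>m\<close> only. The case
  \<open>m = 2\<close> at an element with \<open>\<epsilon> x = -1\<close> shows that this integer can be chosen uniformly.\<close>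

lemma approx_inner_cyclic:
  assumes N: "N \<lhd> G" "finite_index N G" and B: "free_basis (G\<lparr>carrier := N\<rparr>) {a}"
    and \<psi>: "approx_inner G N \<psi>" and id: "\<And>x. x \<in> N \<Longrightarrow> \<psi> x = x"
  obtains p where "p \<in> N" "\<And>x. x \<in> carrier G \<Longrightarrow> \<psi> x = p \<otimes> x \<otimes> inv p"
proof -
  let ?F = "G\<lparr>carrier := N\<rparr>"
  have sub: "subgroup N G"
    using N(1) by (rule normal_imp_subgroup)
  note NG = subgroup.mem_carrier[OF sub]
  interpret F: group ?F
    by (rule subgroup_imp_group[OF sub])
  have invF: "inv\<^bsub>?F\<^esub> x = inv x" if "x \<in> N" for x
    using m_inv_consistent[OF sub that] .
  have conjN: "x \<otimes> y \<otimes> inv x \<in> N" if "x \<in> carrier G" "y \<in> N" for x y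
    using N(1) that unfolding normal_inv_iff by blast
  have aN: "a \<in> N"
    using F.free_basis_subset[OF B] by simp
  obtain \<rho> :: "'a \<Rightarrow> int" where \<rho>: "\<rho> \<in> hom ?F integer_group" "\<rho> a = 1"
      and gen: "\<And>x. x \<in> carrier ?F \<Longrightarrow> x = a [^]\<^bsub>?F\<^esub> \<rho> x"
    using F.free_basis_singleton[OF B] by blast
  have \<rho>_mult: "\<rho> (x \<otimes> y) = \<rho> x + \<rho> y" if "x \<in> N" "y \<in> N" for x y
    using hom_mult[OF \<rho>(1), of x y] that by simp
  have \<rho>_inv: "\<rho> (inv x) = - \<rho> x" if "x \<in> N" for x
    using \<rho>_mult[of x "inv x"] \<rho>_mult[of \<one> \<one>] that NG subgroup.m_inv_closed[OF sub that]
      subgroup.one_closed[OF sub] by simp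
  have \<rho>_inj: "x = y" if "x \<in> N" "y \<in> N" "\<rho> x = \<rho> y" for x y
    using gen[of x] gen[of y] that by simp
  \<comment> \<open>Conjugation by \<open>x\<close> multiplies exponents by that of the conjugated
    generator.\<close>
  define \<epsilon> where "\<epsilon> x = \<rho> (x \<otimes> a \<otimes> inv x)" for x
  have \<epsilon>: "\<rho> (x \<otimes> y \<otimes> inv x) = \<epsilon> x * \<rho> y" if x: "x \<in> carrier G" and y: "y \<in> N" for x y
  proof -
    have h1: "(\<lambda>y. \<rho> (x \<otimes> y \<otimes> inv x)) \<in> hom ?F integer_group"
    proof (rule homI)
      fix u v assume uv: "u \<in> carrier ?F" "v \<in> carrier ?F"
      have "x \<otimes> (u \<otimes> v) \<otimes> inv x = (x \<otimes> u \<otimes> inv x) \<otimes> (x \<otimes> v \<otimes> inv x)"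
        using uv x NG by (simp add: m_assoc)
      then show "\<rho> (x \<otimes> (u \<otimes>\<^bsub>?F\<^esub> v) \<otimes> inv x) =
          \<rho> (x \<otimes> u \<otimes> inv x) \<otimes>\<^bsub>integer_group\<^esub> \<rho> (x \<otimes> v \<otimes> inv x)"
        using \<rho>_mult[OF conjN[OF x] conjN[OF x], of u v] uv by simp
    qed simp
    have h2: "(\<lambda>y. \<epsilon> x * \<rho> y) \<in> hom ?F integer_group"
      by (rule homI) (simp_all add: \<rho>_mult distrib_left)
    show ?thesis
      by (rule F.hom_eq_on_basis[OF B group_integer_group h1 h2])
         (use y \<rho>(2) in \<open>auto simp: \<epsilon>_def\<close>)
  qed
  \<comment> \<open>Conjugation by \<open>inv x\<close> undoes conjugation by \<open>x\<close>, so
    \<open>\<epsilon> x\<close> is a unit of the integers.\<close>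
  have sign: "\<epsilon> x = 1 \<or> \<epsilon> x = - 1" if x: "x \<in> carrier G" for x
  proof -
    have "\<rho> (inv x \<otimes> (x \<otimes> a \<otimes> inv x) \<otimes> inv (inv x)) = \<epsilon> (inv x) * \<epsilon> x"
      using \<epsilon>[OF _ conjN[OF x aN], of "inv x"] x by (simp add: \<epsilon>_def)
    moreover have "inv x \<otimes> (x \<otimes> a \<otimes> inv x) \<otimes> inv (inv x) = a"
      using x NG[OF aN] by (simp add: m_assoc)
    ultimately have "\<epsilon> x * \<epsilon> (inv x) = 1"
      using \<rho>(2) by (simp add: mult.commute)
    then show ?thesis
      by (simp add: zmult_eq_1_iff) blast
  qed
  define z where "z x = \<psi> x \<otimes> inv x" for x
  have zN: "z x \<in> N" if "x \<in> carrier G" for x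
    using approx_inner_mod[OF \<psi> N that] by (simp add: z_def)
  have hom: "\<psi> \<in> hom G G"
    using \<psi> by (simp add: approx_inner_def)
  have comm: "n \<otimes> (x \<otimes> inv n \<otimes> inv x) \<in> N" "\<rho> (n \<otimes> (x \<otimes> inv n \<otimes> inv x)) = (1 - \<epsilon> x) * \<rho> n"
    if "n \<in> N" "x \<in> carrier G" for n x
    using that conjN[of x "inv n"] subgroup.m_inv_closed[OF sub] subgroup.m_closed[OF sub]
    by (simp_all add: \<rho>_mult \<epsilon> \<rho>_inv algebra_simps)
  \<comment> \<open>The elements of \<open>N\<close> with exponent divisible by \<open>m\<close>
    form a subgroup of finite index. A conjugator \<open>n\<close> modulo its core in
    \<open>G\<close> supplies the witness \<open>k = \<rho> n\<close>.\<close>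
  have approx: "\<exists>k. \<forall>x\<in>carrier G. int m dvd \<rho> (z x) - (1 - \<epsilon> x) * k" if m: "m > 0" for m
  proof -
    let ?Z = "integer_mod_group m"
    have h: "(\<lambda>x. \<rho> x mod int m) \<in> hom ?F ?Z"
      using m by (auto simp: hom_def carrier_integer_mod_group \<rho>_mult mod_add_eq)
    have "finite (carrier ?Z)"
      using m by (simp add: carrier_integer_mod_group)
    note ker = F.kernel_finite_index[OF group_integer_mod_group this h]
    obtain M where M: "M \<lhd> G" "finite_index M G" "M \<subseteq> kernel ?F ?Z (\<lambda>x. \<rho> x mod int m)"
      using finite_index_core[OF finite_index_trans[OF N(2) ker(2)]] .
    then obtain n where n: "n \<in> N" "\<And>x. x \<in> carrier G \<Longrightarrow> \<psi> x \<in> M #> (n \<otimes> x \<otimes> inv n)"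
      using \<psi> unfolding approx_inner_def by blast
    have "int m dvd \<rho> (z x) - (1 - \<epsilon> x) * \<rho> n" if x: "x \<in> carrier G" for x
    proof -
      obtain \<mu> where \<mu>: "\<mu> \<in> M" "\<psi> x = \<mu> \<otimes> (n \<otimes> x \<otimes> inv n)"
        using n(2)[OF x] by (auto simp: r_coset_def)
      then have \<mu>N: "\<mu> \<in> N" "int m dvd \<rho> \<mu>"
        using M(3) by (auto simp: kernel_def)
      have "z x = \<mu> \<otimes> (n \<otimes> (x \<otimes> inv n \<otimes> inv x))"
        using \<mu>(2) \<mu>N(1) n(1) x NG by (simp add: z_def m_assoc)
      then have "\<rho> (z x) = \<rho> \<mu> + (1 - \<epsilon> x) * \<rho> n"
        using \<rho>_mult[OF \<mu>N(1) comm(1)[OF n(1) x]] comm(2)[OF n(1) x] by simp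
      then show ?thesis
        using \<mu>N(2) by simp
    qed
    then show ?thesis
      by blast
  qed
  have zero: "i = 0" if "\<And>m. m > 0 \<Longrightarrow> int m dvd i" for i
    using dvd_imp_le_int[OF _ that[of "nat \<bar>i\<bar> + 1"]] by fastforce
  obtain q where q: "\<And>x. x \<in> carrier G \<Longrightarrow> \<rho> (z x) = (1 - \<epsilon> x) * q"
  proof (cases "\<exists>y\<in>carrier G. \<epsilon> y = - 1")
    case True
    then obtain y where y: "y \<in> carrier G" "\<epsilon> y = - 1"
      by blast
    obtain k where "\<forall>x\<in>carrier G. int 2 dvd \<rho> (z x) - (1 - \<epsilon> x) * k"
      using approx[of 2] by auto
    \<comment> \<open>At \<open>y\<close> the factor \<open>1 - \<epsilon> y\<close> equals 2, so
      \<open>\<rho> (z y)\<close> is even; half of it is the uniform integer.\<close>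
    then have "2 dvd \<rho> (z y) - 2 * k"
      using y by force
    then obtain q where q: "\<rho> (z y) = 2 * q"
      by (auto simp: dvd_diff_left_iff elim!: evenE)
    have "\<rho> (z x) = (1 - \<epsilon> x) * q" if x: "x \<in> carrier G" for x
    proof -
      have "\<rho> (z x) - (1 - \<epsilon> x) * q = 0"
      proof (rule zero)
        fix m :: nat assume "m > 0"
        then obtain k where k: "\<forall>x\<in>carrier G. int m dvd \<rho> (z x) - (1 - \<epsilon> x) * k"
          using approx by blast
        \<comment> \<open>Agreement of \<open>2 * q\<close> with \<open>2 * k\<close> modulo
          \<open>m\<close> suffices, because \<open>1 - \<epsilon> x\<close> is 0 or 2.\<close>
        then have "int m dvd \<rho> (z x) - (1 - \<epsilon> x) * k" "int m dvd 2 * q - 2 * k"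
          using x y q by force+
        then show "int m dvd \<rho> (z x) - (1 - \<epsilon> x) * q"
          using sign[OF x] dvd_diff[of "int m" "\<rho> (z x) - 2 * k" "2 * q - 2 * k"] by auto
      qed
      then show ?thesis
        by simp
    qed
    then show ?thesis
      using that by blast
  next
    case False
    \<comment> \<open>All signs are 1 here, so \<open>\<rho> (z x)\<close> is divisible by every
      positive \<open>m\<close> and vanishes; any \<open>q\<close> would do.\<close>
    have "\<rho> (z x) = (1 - \<epsilon> x) * 0" if x: "x \<in> carrier G" for x
    proof -
      have "\<epsilon> x = 1"
        using False sign[OF x] x by blast
      then have "int m dvd \<rho> (z x)" if "m > 0" for m
        using approx[OF that] x by force
      then show ?thesis
        using zero by simp
    qed
    then show ?thesis
      using that by blast
  qed
  define p where "p = a [^]\<^bsub>?F\<^esub> q"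
  have p: "p \<in> N"
    using F.int_pow_closed[of a q] aN by (simp add: p_def)
  have "\<rho> p = q"
  proof -
    interpret \<rho>: group_hom ?F integer_group \<rho>
      using \<rho>(1) by (simp add: group_hom_def group_hom_axioms_def F.is_group)
    show ?thesis
      using \<rho>.hom_int_pow[of a q] aN \<rho>(2) by (simp add: p_def)
  qed
  show ?thesis
  proof (rule that[OF p])
    fix x assume x: "x \<in> carrier G"
    \<comment> \<open>Both sides lie in \<open>N\<close> and have exponent
      \<open>(1 - \<epsilon> x) * q\<close>.\<close>
    have "z x = p \<otimes> (x \<otimes> inv p \<otimes> inv x)"
      using \<rho>_inj[OF zN[OF x] comm(1)[OF p x]] comm(2)[OF p x] q[OF x] \<open>\<rho> p = q\<close> by simp
    then have "\<psi> x \<otimes> inv x \<otimes> x = p \<otimes> (x \<otimes> inv p \<otimes> inv x) \<otimes> x"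
      by (simp add: z_def)
    then show "\<psi> x = p \<otimes> x \<otimes> inv p"
      using x NG[OF p] hom_in_carrier[OF hom x] by (simp add: m_assoc)
  qed
qed

theorem approx_inner_free_by_finite:
  assumes N: "N \<lhd> G" "finite_index N G" and B: "free_basis (G\<lparr>carrier := N\<rparr>) B"
    and \<psi>: "approx_inner G N \<psi>"
  obtains g where "g \<in> carrier G" "\<And>x. x \<in> carrier G \<Longrightarrow> \<psi> x = g \<otimes> x \<otimes> inv g"
proof -
  let ?F = "G\<lparr>carrier := N\<rparr>"
  have sub: "subgroup N G"
    using N(1) by (rule normal_imp_subgroup)
  note NG = subgroup.mem_carrier[OF sub]
  interpret F: group ?F
    by (rule subgroup_imp_group[OF sub])
  have hom: "\<psi> \<in> hom G G"
    using \<psi> by (simp add: approx_inner_def)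
  have "approx_inner ?F (carrier ?F) \<psi>"
    using approx_inner_restrict[OF \<psi> N] by simp
  then obtain n where n': "n \<in> carrier ?F"
      "\<And>x. x \<in> carrier ?F \<Longrightarrow> \<psi> x = n \<otimes>\<^bsub>?F\<^esub> x \<otimes>\<^bsub>?F\<^esub> inv\<^bsub>?F\<^esub> n"
    using F.approx_inner_free_group[OF B] by blast
  then have n: "n \<in> N" "\<And>x. x \<in> N \<Longrightarrow> \<psi> x = n \<otimes> x \<otimes> inv n"
    using m_inv_consistent[OF sub, of n] by auto
  \<comment> \<open>Undoing the conjugation by \<open>n\<close> gives a map that is the identity on
    \<open>N\<close>.\<close>
  define \<phi> where "\<phi> x = inv n \<otimes> \<psi> x \<otimes> inv (inv n)" for x
  have nG: "n \<in> carrier G"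
    using n(1) by (rule NG)
  have "(\<lambda>x. inv n \<otimes> x) ` N \<subseteq> N"
    using n(1) subgroup.m_closed[OF sub] subgroup.m_inv_closed[OF sub] by blast
  then have \<phi>: "approx_inner G N \<phi>"
    using approx_inner_mono[OF approx_inner_conj[OF \<psi> subgroup.subset[OF sub] inv_closed[OF nG]]]
    by (simp add: \<phi>_def[abs_def])
  have id: "\<phi> x = x" if "x \<in> N" for x
    using n(2)[OF that] nG NG[OF that] by (simp add: \<phi>_def m_assoc)
  have \<phi>hom: "\<phi> \<in> hom G G"
    using \<phi> by (simp add: approx_inner_def)
  obtain p where p: "p \<in> carrier G" "\<And>x. x \<in> carrier G \<Longrightarrow> \<phi> x = p \<otimes> x \<otimes> inv p"
  proof (cases "\<exists>a. B = {a}")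
    case True
    then obtain a where "B = {a}"
      by blast
    then show ?thesis
      using approx_inner_cyclic[OF N _ \<phi> id] B that NG by metis
  next
    case False
    \<comment> \<open>Outside the cyclic case \<open>N\<close> is trivial or free on at least two
      generators, and its centre is trivial.\<close>
    have center: "z = \<one>" if z: "z \<in> N" "\<And>y. y \<in> N \<Longrightarrow> z \<otimes> y = y \<otimes> z" for z
    proof (cases "B = {}")
      case True
      then show ?thesis
        using F.free_basis_obtain_word[OF B, of z] z(1) by force
    next
      case nonempty: False
      then obtain a b where "a \<in> B" "b \<in> B" "a \<noteq> b"
        using False by blast
      then show ?thesis
        using F.free_group_center_trivial[OF B, of a b z] z F.free_basis_subset[OF B] by auto
    qed
    have "\<phi> x = \<one> \<otimes> x \<otimes> inv \<one>" if x: "x \<in> carrier G" for x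
    proof -
      have \<phi>x: "\<phi> x \<in> carrier G"
        using \<phi>hom x by (rule hom_in_carrier)
      have "\<phi> x \<otimes> inv x = \<one>"
      proof (rule center)
        show "\<phi> x \<otimes> inv x \<in> N"
          by (rule approx_inner_mod[OF \<phi> N x])
        fix y assume y: "y \<in> N"
        \<comment> \<open>\<open>\<phi>\<close> fixes both \<open>y\<close> and its conjugate
          \<open>y'\<close>. Applied to \<open>x \<otimes> y' = y \<otimes> x\<close> it shows that
          \<open>x\<close> and \<open>\<phi> x\<close> conjugate \<open>y'\<close> to the same
          element.\<close>
        define y' where "y' = inv x \<otimes> y \<otimes> inv (inv x)"
        have y': "y' \<in> N"
          using N(1) x y unfolding normal_inv_iff y'_def by blast
        have "x \<otimes> y' = y \<otimes> x"
          using x NG[OF y] by (simp add: y'_def m_assoc)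
        then have "\<phi> x \<otimes> y' = y \<otimes> \<phi> x"
          using hom_mult[OF \<phi>hom x NG[OF y']] hom_mult[OF \<phi>hom NG[OF y] x] id[OF y] id[OF y'] by simp
        then have "\<phi> x \<otimes> y' \<otimes> inv x = y \<otimes> \<phi> x \<otimes> inv x"
          by simp
        then show "\<phi> x \<otimes> inv x \<otimes> y = y \<otimes> (\<phi> x \<otimes> inv x)"
          using x \<phi>x NG[OF y] by (simp add: y'_def m_assoc)
      qed
      then have "\<phi> x \<otimes> inv x \<otimes> x = \<one> \<otimes> x"
        by simp
      then show ?thesis
        using x \<phi>x by (simp add: m_assoc)
    qed
    then show ?thesis
      using that[of \<one>] by simp
  qed
  have "\<psi> x = (n \<otimes> p) \<otimes> x \<otimes> inv (n \<otimes> p)" if x: "x \<in> carrier G" for x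
  proof -
    have "\<psi> x = n \<otimes> \<phi> x \<otimes> inv n"
      using x nG hom_in_carrier[OF hom x] by (simp add: \<phi>_def m_assoc)
    then show ?thesis
      using p x nG by (simp add: m_assoc inv_mult_group)
  qed
  then show ?thesis
    using that[of "n \<otimes> p"] nG p(1) by blast
qed

end

section \<open>Residual finiteness\<close>

text \<open>For normal \<open>M\<close> these are the automorphisms that preserve \<open>M\<close>
  and induce an inner automorphism of the quotient.\<close>

definition inner_mod :: "('a, 'b) monoid_scheme \<Rightarrow> 'a set \<Rightarrow> ('a \<Rightarrow> 'a) set" where
  "inner_mod G M = {\<phi> \<in> auto G. \<exists>g\<in>carrier G. \<forall>x\<in>carrier G.
     \<phi> x \<in> M #>\<^bsub>G\<^esub> (g \<otimes>\<^bsub>G\<^esub> x \<otimes>\<^bsub>G\<^esub> inv\<^bsub>G\<^esub> g)}"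

lemma (in group_hom) surj_finite_index_image:
  assumes surj: "h ` carrier G = carrier H" and K: "finite_index K G"
  shows "finite_index (h ` K) H"
proof -
  have sub: "subgroup K G" "finite (rcosets\<^bsub>G\<^esub> K)"
    using K by (auto simp: finite_index_def)
  note KG = subgroup.mem_carrier[OF sub(1)]
  have "rcosets\<^bsub>H\<^esub> (h ` K) \<subseteq> (\<lambda>C. h ` C) ` (rcosets\<^bsub>G\<^esub> K)"
  proof
    fix C assume "C \<in> rcosets\<^bsub>H\<^esub> (h ` K)"
    then obtain x where x: "x \<in> carrier G" "C = h ` K #>\<^bsub>H\<^esub> h x"
      unfolding RCOSETS_def surj[symmetric] by blast
    have "h ` (K #>\<^bsub>G\<^esub> x) = h ` K #>\<^bsub>H\<^esub> h x"
      using x(1) KG by (force simp: r_coset_def image_iff)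
    then show "C \<in> (\<lambda>C. h ` C) ` (rcosets\<^bsub>G\<^esub> K)"
      using x by (auto simp: RCOSETS_def)
  qed
  then have "finite (rcosets\<^bsub>H\<^esub> (h ` K))"
    by (rule finite_subset) (intro finite_imageI sub(2))
  then show ?thesis
    using subgroup_img_is_subgroup[OF sub(1)] by (simp add: finite_index_def)
qed

section \<open>Automorphisms that are inner modulo a normal subgroup\<close>

context group
begin

lemma auto_hom: "\<phi> \<in> auto G \<Longrightarrow> \<phi> \<in> hom G G"
  by (simp add: auto_def)

lemma AutoGroup_apply:
  "\<phi> \<in> auto G \<Longrightarrow> \<chi> \<in> auto G \<Longrightarrow> x \<in> carrier G \<Longrightarrow> (\<phi> \<otimes>\<^bsub>AutoGroup G\<^esub> \<chi>) x = \<phi> (\<chi> x)"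
  by (simp add: mult_AutoGroup compose_def)

lemma AutoGroup_inv_apply:
  assumes "\<phi> \<in> auto G" "x \<in> carrier G"
  shows "inv\<^bsub>AutoGroup G\<^esub> \<phi> \<in> auto G" "\<phi> ((inv\<^bsub>AutoGroup G\<^esub> \<phi>) x) = x"
proof -
  interpret A: group "AutoGroup G" by (rule AutoGroup)
  show inv: "inv\<^bsub>AutoGroup G\<^esub> \<phi> \<in> auto G"
    using A.inv_closed[of \<phi>] assms(1) by (simp add: carrier_AutoGroup)
  have "(\<phi> \<otimes>\<^bsub>AutoGroup G\<^esub> inv\<^bsub>AutoGroup G\<^esub> \<phi>) x = x"
    using assms by (simp add: A.r_inv carrier_AutoGroup one_AutoGroup)
  then show "\<phi> ((inv\<^bsub>AutoGroup G\<^esub> \<phi>) x) = x"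
    using AutoGroup_apply[OF assms(1) inv assms(2)] by simp
qed

lemma inner_aut_in_inner_mod:
  assumes M: "subgroup M G" and g: "g \<in> carrier G"
  shows "inner_aut G g \<in> inner_mod G M"
proof -
  have "inner_aut G g x \<in> M #> (g \<otimes> x \<otimes> inv g)" if "x \<in> carrier G" for x
    using that g rcos_self[OF _ M, of "g \<otimes> x \<otimes> inv g"] by (simp add: inner_aut_def)
  then show ?thesis
    using g inner_aut_auto by (auto simp: inner_mod_def)
qed

lemma subgroup_inner_mod:
  assumes M: "M \<lhd> G"
  shows "subgroup (inner_mod G M) (AutoGroup G)"
proof -
  interpret A: group "AutoGroup G" by (rule AutoGroup)
  have sub: "subgroup M G"
    using M by (rule normal_imp_subgroup)
  note MG = subgroup.mem_carrier[OF sub]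
  have conjM: "x \<otimes> m \<otimes> inv x \<in> M" if "x \<in> carrier G" "m \<in> M" for x m
    using M that unfolding normal_inv_iff by blast
  show ?thesis
  proof (rule A.subgroupI)
    show "inner_mod G M \<subseteq> carrier (AutoGroup G)"
      by (auto simp: inner_mod_def carrier_AutoGroup)
    show "inner_mod G M \<noteq> {}"
      using inner_aut_in_inner_mod[OF sub one_closed] by blast
  next
    fix \<phi> assume "\<phi> \<in> inner_mod G M"
    then obtain g where \<phi>: "\<phi> \<in> auto G" and g: "g \<in> carrier G"
        "\<And>x. x \<in> carrier G \<Longrightarrow> \<phi> x \<in> M #> (g \<otimes> x \<otimes> inv g)"
      by (auto simp: inner_mod_def)
    define \<chi> where "\<chi> = inv\<^bsub>AutoGroup G\<^esub> \<phi>"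
    have \<chi>: "\<chi> \<in> auto G"
      using AutoGroup_inv_apply(1)[OF \<phi> one_closed] by (simp add: \<chi>_def)
    have "\<chi> y \<in> M #> (inv g \<otimes> y \<otimes> inv (inv g))" if y: "y \<in> carrier G" for y
    proof -
      have \<chi>y: "\<chi> y \<in> carrier G"
        using auto_hom[OF \<chi>] y by (rule hom_in_carrier)
      have "y \<in> M #> (g \<otimes> \<chi> y \<otimes> inv g)"
        using g(2)[OF \<chi>y] AutoGroup_inv_apply(2)[OF \<phi> y] by (simp add: \<chi>_def)
      then obtain m where m: "m \<in> M" "y = m \<otimes> (g \<otimes> \<chi> y \<otimes> inv g)"
        by (auto simp: r_coset_def)
      \<comment> \<open>This solves the equation for \<open>\<chi> y\<close>; the error term becomes
        a conjugate of \<open>inv m\<close> and stays in \<open>M\<close>.\<close>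
      have "\<chi> y = (inv g \<otimes> inv m \<otimes> inv (inv g)) \<otimes> (inv g \<otimes> (m \<otimes> (g \<otimes> \<chi> y \<otimes> inv g)) \<otimes> inv (inv g))"
        using g(1) MG[OF m(1)] \<chi>y by (simp add: m_assoc)
      then have "\<chi> y = (inv g \<otimes> inv m \<otimes> inv (inv g)) \<otimes> (inv g \<otimes> y \<otimes> inv (inv g))"
        by (simp only: m(2)[symmetric])
      moreover have "inv g \<otimes> inv m \<otimes> inv (inv g) \<in> M"
        using conjM[of "inv g" "inv m"] g(1) subgroup.m_inv_closed[OF sub m(1)] by blast
      ultimately show ?thesis
        unfolding r_coset_def by blast
    qed
    then show "inv\<^bsub>AutoGroup G\<^esub> \<phi> \<in> inner_mod G M"
      using \<chi> g(1) unfolding inner_mod_def \<chi>_def[symmetric] by blast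
  next
    fix \<phi> \<chi> assume "\<phi> \<in> inner_mod G M" "\<chi> \<in> inner_mod G M"
    then obtain g h where \<phi>: "\<phi> \<in> auto G" and g: "g \<in> carrier G"
        "\<And>x. x \<in> carrier G \<Longrightarrow> \<phi> x \<in> M #> (g \<otimes> x \<otimes> inv g)"
      and \<chi>: "\<chi> \<in> auto G" and h: "h \<in> carrier G"
        "\<And>x. x \<in> carrier G \<Longrightarrow> \<chi> x \<in> M #> (h \<otimes> x \<otimes> inv h)"
      unfolding inner_mod_def by blast
    have "\<phi> (\<chi> x) \<in> M #> ((g \<otimes> h) \<otimes> x \<otimes> inv (g \<otimes> h))" if x: "x \<in> carrier G" for x
    proof -
      have hx: "h \<otimes> x \<otimes> inv h \<in> carrier G"
        using h(1) x by simp
      obtain m where m: "m \<in> M" "\<chi> x = m \<otimes> (h \<otimes> x \<otimes> inv h)"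
        using h(2)[OF x] by (auto simp: r_coset_def)
      note mG = MG[OF m(1)]
      obtain k where k: "k \<in> M" "\<phi> m = k \<otimes> (g \<otimes> m \<otimes> inv g)"
        using g(2)[OF mG] by (auto simp: r_coset_def)
      obtain l where l: "l \<in> M" "\<phi> (h \<otimes> x \<otimes> inv h) = l \<otimes> (g \<otimes> (h \<otimes> x \<otimes> inv h) \<otimes> inv g)"
        using g(2)[OF hx] by (auto simp: r_coset_def)
      \<comment> \<open>Being a conjugation modulo \<open>M\<close>, \<open>\<phi>\<close> maps
        \<open>M\<close> into itself, so the error \<open>m\<close> of \<open>\<chi>\<close> remains
        in \<open>M\<close> after applying \<open>\<phi>\<close>.\<close>
      have "\<phi> m \<in> M"
        using k conjM[OF g(1) m(1)] subgroup.m_closed[OF sub] by simp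
      then have "\<phi> m \<otimes> l \<in> M"
        using l(1) by (rule subgroup.m_closed[OF sub])
      moreover have "\<phi> (\<chi> x) = \<phi> m \<otimes> \<phi> (h \<otimes> x \<otimes> inv h)"
        using hom_mult[OF auto_hom[OF \<phi>] mG hx] m(2) by simp
      then have "\<phi> (\<chi> x) = (\<phi> m \<otimes> l) \<otimes> ((g \<otimes> h) \<otimes> x \<otimes> inv (g \<otimes> h))"
        using l(2) MG[OF l(1)] MG[OF \<open>\<phi> m \<in> M\<close>] g(1) h(1) x by (simp add: m_assoc inv_mult_group)
      ultimately show ?thesis
        unfolding r_coset_def by blast
    qed
    then have "\<forall>x\<in>carrier G. (\<phi> \<otimes>\<^bsub>AutoGroup G\<^esub> \<chi>) x \<in> M #> ((g \<otimes> h) \<otimes> x \<otimes> inv (g \<otimes> h))"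
      using AutoGroup_apply[OF \<phi> \<chi>] by simp
    moreover have "\<phi> \<otimes>\<^bsub>AutoGroup G\<^esub> \<chi> \<in> auto G"
      using A.m_closed[of \<phi> \<chi>] \<phi> \<chi> by (simp add: carrier_AutoGroup)
    ultimately show "\<phi> \<otimes>\<^bsub>AutoGroup G\<^esub> \<chi> \<in> inner_mod G M"
      using m_closed[OF g(1) h(1)] unfolding inner_mod_def by blast
  qed
qed

text \<open>An automorphism is determined modulo \<open>M\<close> by the cosets of the images of finitely many
  generators.\<close>

lemma finite_index_inner_mod:
  assumes fg: "finitely_generated_group G" and M: "M \<lhd> G" "finite_index M G"
  shows "finite_index (inner_mod G M) (AutoGroup G)"
proof -
  interpret A: group "AutoGroup G" by (rule AutoGroup)
  interpret M: normal M G by (rule M)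
  have sub: "subgroup M G"
    using M(1) by (rule normal_imp_subgroup)
  have fin: "finite (rcosets M)"
    using M(2) by (simp add: finite_index_def)
  obtain S where S: "finite S" "S \<subseteq> carrier G" "generate G S = carrier G"
    using fg by (auto simp: finitely_generated_group_def)
  define f where "f \<phi> = (\<lambda>s\<in>S. M #> \<phi> s)" for \<phi> :: "'a \<Rightarrow> 'a"
  show ?thesis
  proof (rule A.finite_indexI[OF subgroup_inner_mod[OF M(1)], where f = f])
    have "M #> \<phi> s \<in> rcosets M" if "\<phi> \<in> auto G" "s \<in> S" for \<phi> s
      using hom_in_carrier[OF auto_hom[OF that(1)]] that(2) S(2)
      by (intro rcosetsI subgroup.subset[OF sub]) blast
    then have "f \<phi> \<in> S \<rightarrow>\<^sub>E rcosets M" if "\<phi> \<in> auto G" for \<phi>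
      using that unfolding f_def restrict_PiE_iff by blast
    then have "f ` carrier (AutoGroup G) \<subseteq> S \<rightarrow>\<^sub>E rcosets M"
      unfolding carrier_AutoGroup by blast
    then show "finite (f ` carrier (AutoGroup G))"
      by (rule finite_subset) (intro finite_PiE S(1) fin)
  next
    fix \<phi> \<chi> assume "\<phi> \<in> carrier (AutoGroup G)" "\<chi> \<in> carrier (AutoGroup G)" and f: "f \<phi> = f \<chi>"
    then have auto: "\<phi> \<in> auto G" "\<chi> \<in> auto G"
      by (simp_all add: carrier_AutoGroup)
    interpret \<phi>: group_hom G G \<phi>
      using auto_hom[OF auto(1)] by unfold_locales
    interpret \<chi>: group_hom G G \<chi>
      using auto_hom[OF auto(2)] by unfold_locales
    interpret Q: group "G Mod M"
      by (rule M.factorgroup_is_group)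
    interpret q: group_hom G "G Mod M" "\<lambda>x. M #> x"
      using M.r_coset_hom_Mod by unfold_locales
    \<comment> \<open>Followed by the quotient map, both automorphisms are homomorphisms to
      \<open>G Mod M\<close> that agree on generators.\<close>
    have eq: "M #> \<phi> x = M #> \<chi> x" if "x \<in> carrier G" for x
      using that unfolding S(3)[symmetric]
    proof (induction rule: generate.induct)
      case (incl h)
      then show ?case
        using fun_cong[OF f, of h] by (simp add: f_def)
    next
      case (inv h)
      then have "M #> \<phi> h = M #> \<chi> h" "h \<in> carrier G"
        using fun_cong[OF f, of h] S(2) by (auto simp: f_def)
      then show ?case
        using q.hom_inv[of "\<phi> h"] q.hom_inv[of "\<chi> h"] by simp
    next
      case (eng h k)
      then have "h \<in> carrier G" "k \<in> carrier G"
        using S(3) by auto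
      then show ?case
        using eng q.hom_mult[of "\<phi> h" "\<phi> k"] q.hom_mult[of "\<chi> h" "\<chi> k"] by simp
    qed simp
    let ?\<eta> = "inv\<^bsub>AutoGroup G\<^esub> \<chi>"
    have \<eta>: "?\<eta> \<in> auto G"
      by (rule AutoGroup_inv_apply(1)[OF auto(2) one_closed])
    \<comment> \<open>The quotient of the two automorphisms is trivial modulo \<open>M\<close>, so
      the identity serves as conjugator.\<close>
    have "(\<phi> \<otimes>\<^bsub>AutoGroup G\<^esub> ?\<eta>) y \<in> M #> (\<one> \<otimes> y \<otimes> inv \<one>)" if y: "y \<in> carrier G" for y
    proof -
      have \<eta>y: "?\<eta> y \<in> carrier G"
        using auto_hom[OF \<eta>] y by (rule hom_in_carrier)
      have "\<phi> (?\<eta> y) \<in> M #> \<phi> (?\<eta> y)"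
        using \<eta>y by (intro rcos_self sub) simp
      then show ?thesis
        using eq[OF \<eta>y] AutoGroup_inv_apply(2)[OF auto(2) y] AutoGroup_apply[OF auto(1) \<eta> y] y by simp
    qed
    moreover have "\<phi> \<otimes>\<^bsub>AutoGroup G\<^esub> ?\<eta> \<in> auto G"
      using A.m_closed[of \<phi> ?\<eta>] auto \<eta> by (simp add: carrier_AutoGroup)
    ultimately show "\<phi> \<otimes>\<^bsub>AutoGroup G\<^esub> ?\<eta> \<in> inner_mod G M"
      unfolding inner_mod_def by blast
  qed
qed

text \<open>Conjugating by \<open>inv c\<close> moves the conjugators into \<open>N\<close>, where
  \<open>approx_inner_free_by_finite\<close> applies; undoing this gives conjugation by
  \<open>c \<otimes> g\<close>.\<close>

lemma locally_inner_imp_inner: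
  assumes free: "free_by_finite G" and \<phi>: "\<phi> \<in> auto G"
    and inner: "\<And>M. M \<lhd> G \<Longrightarrow> finite_index M G \<Longrightarrow> \<phi> \<in> inner_mod G M"
  shows "\<phi> \<in> Inn G"
proof -
  obtain N B where N: "N \<lhd> G" "finite_index N G" and B: "free_basis (G\<lparr>carrier := N\<rparr>) B"
    using free by (auto simp: free_by_finite_def free_group_def)
  have "approx_inner G (carrier G) \<phi>"
    using inner auto_hom[OF \<phi>] by (auto simp: approx_inner_def inner_mod_def)
  then obtain c where c: "c \<in> carrier G" "approx_inner G N (\<lambda>x. inv c \<otimes> \<phi> x \<otimes> inv (inv c))"
    using approx_inner_shift N by blast
  obtain g where g: "g \<in> carrier G"
      "\<And>x. x \<in> carrier G \<Longrightarrow> inv c \<otimes> \<phi> x \<otimes> inv (inv c) = g \<otimes> x \<otimes> inv g"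
    using approx_inner_free_by_finite[OF N B c(2)] by blast
  have "\<phi> x = inner_aut G (c \<otimes> g) x" for x
  proof (cases "x \<in> carrier G")
    case True
    have "\<phi> x \<in> carrier G"
      using auto_hom[OF \<phi>] True by (rule hom_in_carrier)
    then have "\<phi> x = c \<otimes> (inv c \<otimes> \<phi> x \<otimes> inv (inv c)) \<otimes> inv c"
      using c(1) by (simp add: m_assoc)
    also have "\<dots> = inner_aut G (c \<otimes> g) x"
      unfolding g(2)[OF True] using True c(1) g(1) by (simp add: inner_aut_def m_assoc inv_mult_group)
    finally show ?thesis .
  next
    \<comment> \<open>Off the carrier both functions are \<open>undefined\<close>, automorphisms
      being extensional.\<close>
    case False
    then show ?thesis
      using \<phi> by (simp add: inner_aut_def auto_def Bij_def extensional_def)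
  qed
  then have "\<phi> = inner_aut G (c \<otimes> g)"
    by blast
  then show ?thesis
    using c(1) g(1) by (simp add: Inn_def)
qed

end

theorem corollary2p5:
  fixes G :: "('a, 'b) monoid_scheme"
  assumes "group G"
    and "finitely_generated_group G"
    and "free_by_finite G"
  shows "residually_finite (Out G)"
proof -
  interpret group G by fact
  interpret A: group "AutoGroup G" by (rule AutoGroup)
  interpret I: normal "Inn G" "AutoGroup G" by (rule Inn_normal)
  interpret O: group "Out G" by (rule group_Out)
  define q where "q \<phi> = Inn G #>\<^bsub>AutoGroup G\<^esub> \<phi>" for \<phi>
  interpret q: group_hom "AutoGroup G" "Out G" q
    using I.r_coset_hom_Mod by unfold_locales (simp add: q_def[abs_def] Out_def)
  have surj: "q ` carrier (AutoGroup G) = carrier (Out G)"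
    by (auto simp: q_def Out_def FactGroup_def RCOSETS_def)
  have "C = \<one>\<^bsub>Out G\<^esub>" if C: "\<And>H. finite_index H (Out G) \<Longrightarrow> C \<in> H" for C
  proof -
    have "C \<in> carrier (Out G)"
      using C O.finite_index_carrier by blast
    then obtain \<phi> where \<phi>: "\<phi> \<in> carrier (AutoGroup G)" "C = q \<phi>"
      using surj by blast
    \<comment> \<open>The image of \<open>inner_mod G M\<close> in \<open>Out G\<close> has finite
      index and so contains \<open>C\<close>. Since \<open>inner_mod G M\<close> contains
      \<open>Inn G\<close>, it is a union of cosets of \<open>Inn G\<close> and contains
      \<open>\<phi>\<close> itself.\<close>
    have "\<phi> \<in> inner_mod G M" if M: "M \<lhd> G" "finite_index M G" for M
    proof -
      let ?K = "inner_mod G M"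
      have K: "subgroup ?K (AutoGroup G)"
        by (rule subgroup_inner_mod[OF M(1)])
      have "q \<phi> \<in> q ` ?K"
        using C[OF q.surj_finite_index_image[OF surj finite_index_inner_mod[OF assms(2) M]]] \<phi>(2) by simp
      then obtain \<chi> where \<chi>: "\<chi> \<in> ?K" "q \<phi> = q \<chi>"
        by blast
      then have "\<phi> \<in> Inn G #>\<^bsub>AutoGroup G\<^esub> \<chi>"
        using A.rcos_self[OF \<phi>(1) I.subgroup_axioms] by (simp add: q_def)
      then obtain \<iota> where "\<iota> \<in> Inn G" "\<phi> = \<iota> \<otimes>\<^bsub>AutoGroup G\<^esub> \<chi>"
        by (auto simp: r_coset_def)
      moreover have "Inn G \<subseteq> ?K"
        using inner_aut_in_inner_mod[OF normal_imp_subgroup[OF M(1)]] by (auto simp: Inn_def)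
      ultimately show ?thesis
        using subgroup.m_closed[OF K _ \<chi>(1)] by blast
    qed
    then have "\<phi> \<in> Inn G"
      using locally_inner_imp_inner[OF assms(3)] \<phi>(1) by (simp add: carrier_AutoGroup)
    then show ?thesis
      using A.coset_join2[OF \<phi>(1) I.subgroup_axioms] \<phi>(2) by (simp add: q_def Out_def FactGroup_def)
  qed
  moreover have "\<one>\<^bsub>Out G\<^esub> \<in> H" if "finite_index H (Out G)" for H
    using that by (simp add: finite_index_def subgroup.one_closed)
  ultimately show ?thesis
    using group_Out unfolding residually_finite_def by blast
qed

end
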